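(* For every positive integer $k$, the graph class $\mathcal{G}_k$, consisting of all graphs each of whose blocks is either planar or can be reduced to a forest by removing at most $k$ vertices, is both addable and minor-closed.
   Context: All graphs are finite and simple; graph classes are closed under isomorphism. A block of a graph is a maximal connected subgraph without a cutvertex (of itself); a single edge counts as a block. $\mathcal{G}_k$ is the class of all graphs with the property that every block is either planar or can be reduced to a forest by removing at most $k$ vertices. A class $\mathcal{G}$ of graphs is minor-closed if every minor of a graph $G\in\mathcal{G}$ is again in $\mathcal{G}$. It is addable if (1) the disjoint union of any two graphs $G,H\in\mathcal{G}$ belongs to $\mathcal{G}$, and (2) for every $G\in\mathcal{G}$, any graph obtained from $G$ by adding an edge between two vertices in distinct components of $G$ is again in $\mathcal{G}$. *)

theory Defs
  imports "HOL-Analysis.Analysis"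
begin

datatype 'a graph = Graph (verts: "'a set") (edges: "'a set set")

definition simple_graph :: "'a graph \<Rightarrow> bool" where
  "simple_graph G \<longleftrightarrow> finite (verts G) \<and>
     (\<forall>e\<in>edges G. \<exists>u\<in>verts G. \<exists>v\<in>verts G. u \<noteq> v \<and> e = {u, v})"

definition subgraph :: "'a graph \<Rightarrow> 'a graph \<Rightarrow> bool" where
  "subgraph H G \<longleftrightarrow> simple_graph H \<and> verts H \<subseteq> verts G \<and> edges H \<subseteq> edges G"

definition graph_iso :: "'a graph \<Rightarrow> 'b graph \<Rightarrow> bool" where
  "graph_iso G H \<longleftrightarrow>
     (\<exists>f. bij_betw f (verts G) (verts H) \<and> edges H = (\<lambda>e. f ` e) ` edges G)"

definition adjacent :: "'a graph \<Rightarrow> 'a \<Rightarrow> 'a \<Rightarrow> bool" where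
  "adjacent G u v \<longleftrightarrow> {u, v} \<in> edges G"

definition component_of :: "'a graph \<Rightarrow> 'a \<Rightarrow> 'a set" where
  "component_of G v = {w \<in> verts G. (adjacent G)\<^sup>*\<^sup>* v w}"

definition connected_graph :: "'a graph \<Rightarrow> bool" where
  "connected_graph G \<longleftrightarrow>
     verts G \<noteq> {} \<and> (\<forall>u\<in>verts G. \<forall>v\<in>verts G. component_of G u = component_of G v)"

definition del_verts :: "'a graph \<Rightarrow> 'a set \<Rightarrow> 'a graph" where
  "del_verts G S = Graph (verts G - S) {e \<in> edges G. e \<inter> S = {}}"

definition del_edge :: "'a graph \<Rightarrow> 'a set \<Rightarrow> 'a graph" where
  "del_edge G e = Graph (verts G) (edges G - {e})"

definition add_edge :: "'a graph \<Rightarrow> 'a \<Rightarrow> 'a \<Rightarrow> 'a graph" where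
  "add_edge G u v = Graph (verts G) (insert {u, v} (edges G))"

(* The merged vertex is represented by u; no loops or parallel edges arise. *)
definition contract_edge :: "'a graph \<Rightarrow> 'a \<Rightarrow> 'a \<Rightarrow> 'a graph" where
  "contract_edge G u v = Graph (verts G - {v})
     ({e \<in> edges G. v \<notin> e} \<union> {{u, w} |w. {v, w} \<in> edges G \<and> w \<noteq> u})"

definition disjoint_sum :: "'a graph \<Rightarrow> 'b graph \<Rightarrow> ('a + 'b) graph" where
  "disjoint_sum G H =
     Graph (verts G <+> verts H) ((\<lambda>e. Inl ` e) ` edges G \<union> (\<lambda>e. Inr ` e) ` edges H)"


definition cutvertex :: "'a graph \<Rightarrow> 'a \<Rightarrow> bool" where
  "cutvertex G v \<longleftrightarrow> v \<in> verts G \<and>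
     (\<exists>x\<in>verts G - {v}. \<exists>y\<in>verts G - {v}. component_of G x = component_of G y \<and>
        component_of (del_verts G {v}) x \<noteq> component_of (del_verts G {v}) y)"

definition connected_no_cutvertex :: "'a graph \<Rightarrow> bool" where
  "connected_no_cutvertex G \<longleftrightarrow> connected_graph G \<and> (\<nexists>v. cutvertex G v)"

definition block :: "'a graph \<Rightarrow> 'a graph \<Rightarrow> bool" where
  "block B G \<longleftrightarrow> subgraph B G \<and> connected_no_cutvertex B \<and>
     (\<forall>B'. subgraph B' G \<and> connected_no_cutvertex B' \<and> subgraph B B' \<longrightarrow> B' = B)"


definition is_cycle :: "'a graph \<Rightarrow> 'a list \<Rightarrow> bool" where
  "is_cycle G xs \<longleftrightarrow> length xs \<ge> 3 \<and> distinct xs \<and>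
     (\<forall>i<length xs. adjacent G (xs ! i) (xs ! (Suc i mod length xs)))"

definition forest :: "'a graph \<Rightarrow> bool" where
  "forest G \<longleftrightarrow> (\<nexists>xs. is_cycle G xs)"


(* A topological drawing in the plane, with vertices as distinct points and edges as simple arcs. *)
definition plane_drawing ::
    "'a graph \<Rightarrow> ('a \<Rightarrow> complex) \<Rightarrow> ('a set \<Rightarrow> real \<Rightarrow> complex) \<Rightarrow> bool" where
  "plane_drawing G p \<gamma> \<longleftrightarrow> inj_on p (verts G) \<and>
     (\<forall>e\<in>edges G. arc (\<gamma> e) \<and> {pathstart (\<gamma> e), pathfinish (\<gamma> e)} = p ` e \<and>
        path_image (\<gamma> e) \<inter> p ` verts G = p ` e) \<and>
     (\<forall>e\<in>edges G. \<forall>f\<in>edges G. e \<noteq> f \<longrightarrow>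
        path_image (\<gamma> e) \<inter> path_image (\<gamma> f) = p ` (e \<inter> f))"

definition planar :: "'a graph \<Rightarrow> bool" where
  "planar G \<longleftrightarrow> (\<exists>p \<gamma>. plane_drawing G p \<gamma>)"


inductive minor_step :: "'a graph \<Rightarrow> 'a graph \<Rightarrow> bool" where
  del_vertex: "v \<in> verts G \<Longrightarrow> minor_step G (del_verts G {v})"
| del_edge: "e \<in> edges G \<Longrightarrow> minor_step G (del_edge G e)"
| contract_edge: "{u, v} \<in> edges G \<Longrightarrow> minor_step G (contract_edge G u v)"

definition minor :: "'b graph \<Rightarrow> 'a graph \<Rightarrow> bool" where
  "minor H G \<longleftrightarrow> (\<exists>H'. minor_step\<^sup>*\<^sup>* G H' \<and> graph_iso H' H)"

definition minor_closed :: "'a graph set \<Rightarrow> bool" where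
  "minor_closed \<G> \<longleftrightarrow> (\<forall>G\<in>\<G>. \<forall>H. minor H G \<longrightarrow> H \<in> \<G>)"

(* Disjoint unions are taken up to isomorphism, as G and H may share vertices. *)
definition addable :: "'a graph set \<Rightarrow> bool" where
  "addable \<G> \<longleftrightarrow>
     (\<forall>G\<in>\<G>. \<forall>H\<in>\<G>. \<forall>K. graph_iso (disjoint_sum G H) K \<longrightarrow> K \<in> \<G>) \<and>
     (\<forall>G\<in>\<G>. \<forall>u\<in>verts G. \<forall>v\<in>verts G.
        component_of G u \<noteq> component_of G v \<longrightarrow> add_edge G u v \<in> \<G>)"


definition forest_after_removing :: "nat \<Rightarrow> 'a graph \<Rightarrow> bool" where
  "forest_after_removing k G \<longleftrightarrow> (\<exists>S\<subseteq>verts G. card S \<le> k \<and> forest (del_verts G S))"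

definition block_class :: "nat \<Rightarrow> 'a graph set" where
  "block_class k =
     {G. simple_graph G \<and> (\<forall>B. block B G \<longrightarrow> planar B \<or> forest_after_removing k B)}"

end

theory Submission
  imports Defs "HOL-Complex_Analysis.Riemann_Mapping"
begin

text \<open>
  Call a graph good if it is planar or becomes a forest after deleting at most \<open>k\<close> vertices. Goodness
  passes to subgraphs, and every connected subgraph without a cutvertex lies in a block. So a graph
  is in the class iff all its connected subgraphs without a cutvertex are good
  (\<open>block_class_eq\<close>). This form no longer mentions maximality, which makes it easy to compare
  different graphs: it is inherited along every injective, edge-preserving map
  (\<open>blockwise_good_embeds\<close>), hence by subgraphs and isomorphic copies.

  Addability: a connected subgraph of a disjoint union lies on one side. If an added edge \<open>uv\<close>
  between two components belongs to a subgraph \<open>B\<close> without a cutvertex, then \<open>B\<close> has no third vertex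
  \<open>z\<close>, since otherwise \<open>z\<close> could be reached from \<open>u\<close> avoiding \<open>v\<close> and from \<open>v\<close> avoiding \<open>u\<close>,
  without using \<open>uv\<close>. So \<open>B\<close> is a single edge, and deleting one vertex leaves a forest.

  Closure under minors: only the contraction of an edge \<open>uv\<close> matters
  (\<open>blockwise_good_contract_edge\<close>). Let \<open>B\<close> be a connected subgraph of the contracted graph without
  a cutvertex. If \<open>B\<close> avoids the merged vertex, it is a subgraph of the original graph. Otherwise let
  \<open>L\<close> be its preimage together with the edge \<open>uv\<close>. A cutvertex of \<open>L\<close> can only be \<open>u\<close> or \<open>v\<close>, and
  then the other one is a leaf of \<open>L\<close>; in that case \<open>B\<close> is a copy of a subgraph of the original
  graph. If \<open>L\<close> has no cutvertex, it is good, and it remains to see that goodness survives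
  contraction (\<open>planar_or_near_forest_contract_edge\<close>).

  For forests this is a rerouting of cycles. For planarity (\<open>planar_contract_edge\<close>) the drawing
  consists of arbitrary continuous arcs, and rerouting edges alongside such an arc would need
  control over its neighbourhoods. Instead of redrawing
  edges by hand, the whole plane is mapped to itself by a continuous map that collapses the
  arc of \<open>uv\<close> to a point and is injective elsewhere (\<open>arc_collapsing_map\<close>). Such a map exists because
  the complement of an arc in the Riemann sphere is simply connected, hence homeomorphic to the
  plane by the Riemann mapping theorem; the arc becomes the point at infinity.
\<close>

section \<open>Collapsing an arc in the plane\<close>

text \<open>
  The set is the complement of the arc in the Riemann sphere, moved into the plane by the inversion
  that sends the starting point \<open>g 0\<close> to infinity and infinity to \<open>0\<close>. Its complement in the plane is
  the image of the half-open arc, which is connected and runs off to infinity; so no component of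
  the complement is bounded.
\<close>

lemma simply_connected_inverted_arc_complement:
  fixes g :: "real \<Rightarrow> complex"
  assumes g: "arc g"
  defines "U \<equiv> {z. z = 0 \<or> g 0 + inverse z \<notin> path_image g}"
  shows "open U" "simply_connected U"
proof -
  define a where "a = g 0"
  define A where "A = path_image g"
  define \<tau> where "\<tau> w = inverse (w - a)" for w :: complex
  have aA: "a \<in> A"
    unfolding a_def A_def path_image_def by auto
  have compA: "compact A" and connA: "connected A"
    using g by (auto simp: A_def compact_arc_image connected_arc_image)
  have comp_U: "- U = \<tau> ` (A - {a})"
  proof -
    have "z \<in> - U \<longleftrightarrow> z \<in> \<tau> ` (A - {a})" for z
    proof
      assume "z \<in> - U"
      then have "z \<noteq> 0" "a + inverse z \<in> A"
        by (auto simp: U_def a_def A_def)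
      then show "z \<in> \<tau> ` (A - {a})"
        by (intro image_eqI[of _ _ "a + inverse z"]) (auto simp: \<tau>_def)
    next
      assume "z \<in> \<tau> ` (A - {a})"
      then show "z \<in> - U"
        by (auto simp: U_def \<tau>_def a_def A_def)
    qed
    then show ?thesis by blast
  qed
  have punct_U: "U - {0} = \<tau> ` (- A)"
  proof -
    have "z \<in> U - {0} \<longleftrightarrow> z \<in> \<tau> ` (- A)" for z
    proof
      assume "z \<in> U - {0}"
      then have "z \<noteq> 0" "a + inverse z \<notin> A"
        by (auto simp: U_def a_def A_def)
      then show "z \<in> \<tau> ` (- A)"
        by (intro image_eqI[of _ _ "a + inverse z"]) (auto simp: \<tau>_def)
    next
      assume "z \<in> \<tau> ` (- A)"
      then show "z \<in> U - {0}"
        using aA by (auto simp: U_def \<tau>_def a_def A_def)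
    qed
    then show ?thesis by blast
  qed
  have cont_\<tau>: "continuous_on (- {a}) \<tau>"
    unfolding \<tau>_def by (intro continuous_intros) auto
  obtain R where R: "R > 0" "\<And>w. w \<in> A \<Longrightarrow> norm (w - a) \<le> R"
  proof -
    have "bounded ((\<lambda>w. w - a) ` A)"
      using compA by (simp add: bounded_translation_minus compact_imp_bounded)
    then show thesis
      by (metis bounded_pos imageI that)
  qed
  have near_0: "ball 0 (inverse R) \<subseteq> U"
  proof
    fix z :: complex assume z: "z \<in> ball 0 (inverse R)"
    show "z \<in> U"
    proof (rule ccontr)
      assume "z \<notin> U"
      then have "z \<noteq> 0" "norm (inverse z) \<le> R"
        using R(2)[of "a + inverse z"] by (auto simp: U_def a_def A_def)
      then have "inverse R \<le> norm z"
        using R(1) by (simp add: norm_divide field_simps)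
      with z show False by simp
    qed
  qed
  have "open (- {0} \<inter> (\<lambda>z. a + inverse z) -` (- A))"
  proof (rule continuous_open_preimage)
    show "continuous_on (- {0}) (\<lambda>z. a + inverse z)"
      by (intro continuous_intros) auto
    show "open (- A)"
      using compA by (simp add: compact_imp_closed open_Compl)
  qed auto
  moreover have "U = (- {0} \<inter> (\<lambda>z. a + inverse z) -` (- A)) \<union> ball 0 (inverse R)"
    using near_0 R(1) by (auto simp: U_def a_def A_def)
  ultimately show "open U"
    by (simp only: open_Un open_ball)
  have "connected U"
  proof (rule connected_intermediate_closure)
    have "connected (- A)"
      using g unfolding A_def by (intro connected_arc_complement) auto
    then show "connected (U - {0})"
      unfolding punct_U
      using aA by (intro connected_continuous_image continuous_on_subset[OF cont_\<tau>]) auto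
    have "0 islimpt U"
      by (intro interior_limit_point) (use \<open>open U\<close> in \<open>auto simp: interior_open U_def\<close>)
    then have "0 \<in> closure (U - {0})"
      by (simp add: islimpt_in_closure)
    moreover have "U - {0} \<subseteq> closure (U - {0})"
      by (rule closure_subset)
    ultimately show "U \<subseteq> closure (U - {0})"
      by blast
  qed auto
  moreover have "\<not> bounded C" if C: "C \<in> components (- U)" for C
  proof -
    have "g ` ({0..1} - {0}) = A - {a}"
      using g unfolding A_def a_def path_image_def arc_def
      by (subst inj_on_image_set_diff[of g "{0..1}"]) auto
    moreover have "{0..1} - {0} = {0<..1::real}"
      by auto
    ultimately have "g ` {0<..1} = A - {a}"
      by simp
    moreover have "connected (g ` {0<..1})"
      by (rule connected_continuous_image)
        (use g in \<open>auto simp: arc_def path_def elim: continuous_on_subset\<close>)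
    ultimately have "connected (- U)"
      unfolding comp_U
      by (intro connected_continuous_image continuous_on_subset[OF cont_\<tau>]) auto
    then have "C = - U"
      using C by (metis components_eq_sing_iff components_empty empty_iff singletonD)
    moreover have "\<not> bounded (- U)"
    proof
      assume "bounded (- U)"
      then obtain B where B: "B > 0" "\<And>w. w \<in> A - {a} \<Longrightarrow> norm (\<tau> w) \<le> B"
        unfolding comp_U by (metis bounded_pos imageI)
      \<comment> \<open>A bound on the inverted arc would keep the rest of the arc away from its starting point.\<close>
      have "a islimpt A"
        using connA aA arc_image_uncountable[OF g] connected_imp_perfect[of A a]
        by (metis A_def countable_empty countable_insert)
      then obtain w where "w \<in> A" "w \<noteq> a" "dist w a < inverse B"
        using B(1) by (metis islimpt_approachable positive_imp_inverse_positive)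
      with B show False
        by (force simp: \<tau>_def dist_norm norm_divide field_simps)
    qed
    ultimately show ?thesis by simp
  qed
  ultimately show "simply_connected U"
    using \<open>open U\<close> by (simp add: simply_connected_eq_unbounded_complement_components)
qed

text \<open>
  The map is the inversion at \<open>g 0\<close>, followed by a homeomorphism of the inverted complement of the arc
  with the whole plane, followed by a second inversion. A point approaching the arc leaves every
  compact subset of the complement, so its image tends to infinity before and to \<open>0\<close> after the
  last inversion; thus the value \<open>0\<close> on the arc extends the map continuously.
\<close>

lemma arc_collapsing_map:
  fixes g :: "real \<Rightarrow> complex"
  assumes g: "arc g"
  obtains \<Phi> :: "complex \<Rightarrow> complex"
  where "continuous_on UNIV \<Phi>"
    and "\<And>x y. \<Phi> x = \<Phi> y \<longleftrightarrow> x = y \<or> x \<in> path_image g \<and> y \<in> path_image g"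
proof -
  define a where "a = g 0"
  define A where "A = path_image g"
  define U where "U = {z. z = 0 \<or> a + inverse z \<notin> A}"
  define \<tau> where "\<tau> w = inverse (w - a)" for w :: complex
  have U: "open U" "simply_connected U"
    using simply_connected_inverted_arc_complement[OF g] by (simp_all add: U_def a_def A_def)
  have aA: "a \<in> A"
    unfolding a_def A_def path_image_def by auto
  have closedA: "closed A"
    using g by (simp add: A_def closed_arc_image)
  have "0 \<in> U" by (simp add: U_def)
  have \<tau>_U: "\<tau> w \<in> U \<longleftrightarrow> w \<notin> A" if "w \<noteq> a" for w
    using that by (auto simp: U_def \<tau>_def)
  have \<tau>_0: "\<tau> w = 0 \<longleftrightarrow> w = a" for w
    by (auto simp: \<tau>_def)
  have inj_\<tau>: "\<tau> x = \<tau> y \<longleftrightarrow> x = y" for x y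
    by (auto simp: \<tau>_def)
  have "U homeomorphic ball (0::complex) 1"
    using U \<open>0 \<in> U\<close> simply_connected_eq_homeomorphic_to_disc by blast
  then have "U homeomorphic (UNIV :: complex set)"
    using homeomorphic_ball01_UNIV homeomorphic_trans by blast
  then obtain f f' where f: "homeomorphism U (UNIV :: complex set) f f'"
    by (auto simp: homeomorphic_def)
  define \<Phi> where "\<Phi> w = (if w \<in> A then 0 else inverse (f (\<tau> w) - f 0))" for w
  have inj_f: "f x = f y \<longleftrightarrow> x = y" if "x \<in> U" "y \<in> U" for x y
    using f that by (metis homeomorphism_apply1)
  have nz: "f (\<tau> w) \<noteq> f 0" if "w \<notin> A" for w
    using that inj_f[OF _ \<open>0 \<in> U\<close>, of "\<tau> w"] \<tau>_U \<tau>_0 aA by metis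
  have inj: "\<Phi> x = \<Phi> y \<longleftrightarrow> x = y \<or> x \<in> A \<and> y \<in> A" for x y
  proof (cases "x \<in> A \<or> y \<in> A")
    case True
    then show ?thesis using nz by (auto simp: \<Phi>_def)
  next
    case False
    then have "\<tau> x \<in> U" "\<tau> y \<in> U" using \<tau>_U aA by metis+
    then show ?thesis using False inj_f inj_\<tau> by (simp add: \<Phi>_def)
  qed
  have "isCont \<Phi> w" for w
  proof (cases "w \<in> A")
    case False
    have "continuous_on (- A) (\<lambda>w. inverse (f (\<tau> w) - f 0))"
    proof (intro continuous_intros continuous_on_compose2[OF homeomorphism_cont1[OF f]])
      show "continuous_on (- A) \<tau>"
        unfolding \<tau>_def using aA by (intro continuous_intros) auto
      show "\<tau> ` (- A) \<subseteq> U" using \<tau>_U aA by (metis ComplD image_subsetI)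
      show "\<forall>x\<in>- A. f (\<tau> x) - f 0 \<noteq> 0" using nz by auto
    qed
    then have "continuous_on (- A) \<Phi>"
      by (rule continuous_on_eq) (auto simp: \<Phi>_def)
    then show ?thesis
      using False closedA by (simp add: continuous_on_eq_continuous_at open_Compl)
  next
    case True
    have "(\<Phi> \<longlongrightarrow> 0) (at w)"
    proof (rule tendstoI)
      fix e :: real assume e: "e > 0"
      define K where "K = f' ` cball (f 0) (inverse e)"
      have "compact K"
        unfolding K_def
        by (rule compact_continuous_image[OF _ compact_cball])
          (rule continuous_on_subset[OF homeomorphism_cont2[OF f]], simp)
      have "K \<subseteq> U"
        using f by (auto simp: K_def homeomorphism_def)
      \<comment> \<open>\<open>K\<close> consists of the points that the last inversion does not yet bring \<open>e\<close>-close to \<open>0\<close>.\<close>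
      have ev: "eventually (\<lambda>x. \<tau> x \<notin> K) (at w)"
      proof (cases "w = a")
        case False
        have "\<tau> w \<notin> K" using \<open>K \<subseteq> U\<close> \<tau>_U[OF False] True by blast
        moreover have "(\<tau> \<longlongrightarrow> \<tau> w) (at w)"
          unfolding \<tau>_def using False by (intro tendsto_intros) auto
        ultimately show ?thesis
          using topological_tendstoD[of \<tau> "\<tau> w" "at w" "- K"] \<open>compact K\<close>
          by (simp add: compact_imp_closed open_Compl)
      next
        case True
        obtain B where B: "B > 0" "\<And>z. z \<in> K \<Longrightarrow> norm z \<le> B"
          using \<open>compact K\<close> by (metis bounded_pos compact_imp_bounded)
        have "eventually (\<lambda>x. x \<noteq> a \<and> dist x a < inverse B) (at a)"
          using B(1) by (auto simp: eventually_at intro!: exI[of _ "inverse B"])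
        then show ?thesis
          unfolding True
        proof eventually_elim
          case (elim x)
          then have "norm (\<tau> x) > B"
            using B(1) by (simp add: \<tau>_def norm_divide dist_norm field_simps)
          then show ?case using B(2) by force
        qed
      qed
      then show "eventually (\<lambda>x. dist (\<Phi> x) 0 < e) (at w)"
      proof eventually_elim
        case (elim x)
        show ?case
        proof (cases "x \<in> A")
          case False
          then have "\<tau> x \<in> U" using \<tau>_U aA by metis
          then have "f' (f (\<tau> x)) = \<tau> x" using f by (simp add: homeomorphism_apply1)
          then have "f (\<tau> x) \<notin> cball (f 0) (inverse e)"
            using elim unfolding K_def by (metis imageI)
          then have "inverse e < norm (f (\<tau> x) - f 0)"
            by (simp add: dist_norm norm_minus_commute)
          then have "norm (inverse (f (\<tau> x) - f 0)) < e"
            using e less_imp_inverse_less[of "inverse e"] by (simp add: norm_inverse)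
          then show ?thesis using False by (simp add: \<Phi>_def)
        qed (use e in \<open>simp add: \<Phi>_def\<close>)
      qed
    qed
    then show ?thesis using True by (simp add: isCont_def \<Phi>_def)
  qed
  then have "continuous_on UNIV \<Phi>"
    by (simp add: continuous_at_imp_continuous_on)
  with inj show thesis
    by (intro that) (auto simp: A_def)
qed

section \<open>Embeddings of graphs and contraction of an edge\<close>

text \<open>
  The image need not be induced, so subgraph inclusions and isomorphisms are both special cases.
\<close>

definition embeds :: "('a \<Rightarrow> 'b) \<Rightarrow> 'a graph \<Rightarrow> 'b graph \<Rightarrow> bool" where
  "embeds q H K \<longleftrightarrow> inj_on q (verts H) \<and> q ` verts H \<subseteq> verts K \<and> (\<forall>e\<in>edges H. q ` e \<in> edges K)"

text \<open>The map on vertices that underlies the contraction of the edge \<open>uv\<close> into \<open>u\<close>.\<close>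

definition contract_map :: "'a \<Rightarrow> 'a \<Rightarrow> 'a \<Rightarrow> 'a" where
  "contract_map u v x = (if x = v then u else x)"

lemma simple_graph_edge_subset: "simple_graph G \<Longrightarrow> e \<in> edges G \<Longrightarrow> e \<subseteq> verts G"
  by (auto simp: simple_graph_def)

lemma simple_graph_edgeE:
  assumes "simple_graph G" "e \<in> edges G"
  obtains x y where "e = {x, y}" "x \<noteq> y" "x \<in> verts G" "y \<in> verts G"
  using assms unfolding simple_graph_def by metis

lemma simple_graph_edge_at:
  assumes "simple_graph G" "e \<in> edges G" "x \<in> e"
  obtains y where "e = {x, y}" "x \<noteq> y" "y \<in> verts G"
proof -
  obtain a b where "e = {a, b}" "a \<noteq> b" "a \<in> verts G" "b \<in> verts G"
    using simple_graph_edgeE[OF assms(1,2)] .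
  with \<open>x \<in> e\<close> show thesis
    using that[of a] that[of b] by (auto simp: insert_commute)
qed

lemma simple_graph_edge_neq: "simple_graph G \<Longrightarrow> {x, y} \<in> edges G \<Longrightarrow> x \<noteq> y"
  by (erule simple_graph_edgeE) (auto simp: doubleton_eq_iff)

lemma simple_graph_del_verts: "simple_graph G \<Longrightarrow> simple_graph (del_verts G S)"
  by (fastforce simp: simple_graph_def del_verts_def)

lemma simple_graph_del_edge: "simple_graph G \<Longrightarrow> simple_graph (del_edge G e)"
  by (auto simp: simple_graph_def del_edge_def)

lemma subgraph_embeds: "subgraph H G \<Longrightarrow> embeds id H G"
  by (auto simp: subgraph_def embeds_def)

lemma subgraph_trans: "subgraph A B \<Longrightarrow> subgraph B C \<Longrightarrow> subgraph A C"
  by (auto simp: subgraph_def)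

lemma embeds_comp:
  assumes q: "embeds q G H" and r: "embeds r H K"
  shows "embeds (r \<circ> q) G K"
proof -
  have "inj_on r (q ` verts G)"
    by (rule inj_on_subset[of r "verts H"]) (use q r in \<open>auto simp: embeds_def\<close>)
  then have "inj_on (r \<circ> q) (verts G)"
    using q by (simp add: embeds_def comp_inj_on)
  then show ?thesis
    using q r unfolding embeds_def image_comp[symmetric] by blast
qed

text \<open>
  The embedding goes from the copy back to \<open>G\<close>, because the properties considered here are
  inherited from the target of an embedding by its source.
\<close>

lemma graph_iso_embeds:
  assumes G: "simple_graph G" and "graph_iso G H"
  obtains q where "simple_graph H" "embeds q H G"
proof -
  obtain f where f: "bij_betw f (verts G) (verts H)" "edges H = (\<lambda>e. f ` e) ` edges G"
    using assms(2) by (auto simp: graph_iso_def)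
  define q where "q = inv_into (verts G) f"
  have inj: "inj_on f (verts G)" and im: "f ` verts G = verts H"
    using f(1) by (auto simp: bij_betw_def)
  have "simple_graph H"
    unfolding simple_graph_def
  proof (intro conjI ballI)
    show "finite (verts H)"
      using G im by (metis finite_imageI simple_graph_def)
    fix e assume "e \<in> edges H"
    then obtain e' where e': "e' \<in> edges G" "e = f ` e'"
      using f(2) by blast
    obtain x y where "e' = {x, y}" "x \<noteq> y" "x \<in> verts G" "y \<in> verts G"
      using simple_graph_edgeE[OF G e'(1)] .
    then have "f x \<in> verts H" "f y \<in> verts H" "f x \<noteq> f y" "e = {f x, f y}"
      using inj im e'(2) by (auto simp: inj_on_eq_iff)
    then show "\<exists>u\<in>verts H. \<exists>v\<in>verts H. u \<noteq> v \<and> e = {u, v}"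
      by blast
  qed
  moreover have "embeds q H G"
  proof -
    have "q ` f ` e = e" if "e \<in> edges G" for e
      unfolding q_def using inv_into_image_cancel[OF inj simple_graph_edge_subset[OF G that]] .
    moreover have "bij_betw q (verts H) (verts G)"
      unfolding q_def using f(1) by (rule bij_betw_inv_into)
    ultimately show ?thesis
      using f(2) by (auto simp: embeds_def bij_betw_def)
  qed
  ultimately show thesis by (rule that)
qed

text \<open>
  This identity replaces the two cases in the definition of contraction by a single image, so
  that later proofs can choose a preimage for each edge without distinguishing them.
\<close>

lemma edges_contract_edge:
  assumes G: "simple_graph G"
  shows "edges (contract_edge G u v) = (\<lambda>e. contract_map u v ` e) ` (edges G - {{u, v}})"
proof -
  have fix_off: "contract_map u v ` e = e" if "v \<notin> e" for e
    using that by (force simp: contract_map_def)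
  have at_v: "contract_map u v ` {v, w} = {u, w}" if "w \<noteq> v" for w
    using that by (auto simp: contract_map_def)
  show ?thesis
  proof (intro equalityI subsetI)
    fix e assume "e \<in> edges (contract_edge G u v)"
    then consider "e \<in> edges G" "v \<notin> e" | w where "e = {u, w}" "{v, w} \<in> edges G" "w \<noteq> u"
      by (auto simp: contract_edge_def)
    then show "e \<in> (\<lambda>e. contract_map u v ` e) ` (edges G - {{u, v}})"
    proof cases
      case 1
      then show ?thesis by (intro image_eqI[of _ _ e]) (auto simp: fix_off)
    next
      case 2
      have "w \<noteq> v" using simple_graph_edge_neq[OF G 2(2)] by simp
      then have "e = contract_map u v ` {v, w}" using 2(1) at_v by simp
      moreover have "{v, w} \<noteq> {u, v}" using \<open>w \<noteq> v\<close> 2(3) by (simp add: doubleton_eq_iff)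
      ultimately show ?thesis using 2(2) by blast
    qed
  next
    fix e assume "e \<in> (\<lambda>e. contract_map u v ` e) ` (edges G - {{u, v}})"
    then obtain e' where e': "e' \<in> edges G" "e' \<noteq> {u, v}" "e = contract_map u v ` e'"
      by blast
    show "e \<in> edges (contract_edge G u v)"
    proof (cases "v \<in> e'")
      case False
      with e' show ?thesis by (simp add: contract_edge_def fix_off)
    next
      case True
      then obtain w where "e' = {v, w}" "v \<noteq> w"
        using simple_graph_edge_at[OF G e'(1)] by blast
      then have "e = {u, w}" "w \<noteq> u" "{v, w} \<in> edges G"
        using e' at_v[of w] by (auto simp: insert_commute)
      then show ?thesis by (auto simp: contract_edge_def)
    qed
  qed
qed

lemma simple_graph_contract_edge:
  assumes G: "simple_graph G" and uv: "{u, v} \<in> edges G"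
  shows "simple_graph (contract_edge G u v)"
proof -
  have "u \<noteq> v" "u \<in> verts G"
    using simple_graph_edge_neq[OF G uv] simple_graph_edge_subset[OF G uv] by auto
  have "\<exists>x\<in>verts (contract_edge G u v). \<exists>y\<in>verts (contract_edge G u v). x \<noteq> y \<and> e = {x, y}"
    if e: "e \<in> edges (contract_edge G u v)" for e
  proof -
    consider "e \<in> edges G" "v \<notin> e" | w where "e = {u, w}" "{v, w} \<in> edges G" "w \<noteq> u"
      using e by (auto simp: contract_edge_def)
    then show ?thesis
    proof cases
      case 1
      obtain a b where "e = {a, b}" "a \<noteq> b" "a \<in> verts G" "b \<in> verts G"
        using simple_graph_edgeE[OF G 1(1)] .
      with 1 show ?thesis by (auto simp: contract_edge_def)
    next
      case 2
      then have "w \<in> verts G" "w \<noteq> v"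
        using simple_graph_edge_neq[OF G 2(2)] simple_graph_edge_subset[OF G 2(2)] by auto
      with 2 \<open>u \<noteq> v\<close> \<open>u \<in> verts G\<close> show ?thesis by (auto simp: contract_edge_def)
    qed
  qed
  then show ?thesis
    using G by (simp add: simple_graph_def contract_edge_def)
qed

section \<open>Contraction preserves planarity\<close>

lemma planar_embeds:
  assumes H: "simple_graph H" and q: "embeds q H K" and "planar K"
  shows "planar H"
proof -
  obtain p \<gamma> where d: "plane_drawing K p \<gamma>"
    using \<open>planar K\<close> by (auto simp: planar_def)
  have inj_p: "inj_on p (verts K)"
    and arc: "\<And>e. e \<in> edges K \<Longrightarrow> arc (\<gamma> e)"
    and ends: "\<And>e. e \<in> edges K \<Longrightarrow> {pathstart (\<gamma> e), pathfinish (\<gamma> e)} = p ` e"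
    and verts_on: "\<And>e. e \<in> edges K \<Longrightarrow> path_image (\<gamma> e) \<inter> p ` verts K = p ` e"
    and meet: "\<And>e f. e \<in> edges K \<Longrightarrow> f \<in> edges K \<Longrightarrow> e \<noteq> f \<Longrightarrow>
                 path_image (\<gamma> e) \<inter> path_image (\<gamma> f) = p ` (e \<inter> f)"
    using d by (auto simp: plane_drawing_def)
  have inj: "inj_on q (verts H)" and qV: "q ` verts H \<subseteq> verts K"
    and qE: "\<And>e. e \<in> edges H \<Longrightarrow> q ` e \<in> edges K"
    using q by (auto simp: embeds_def)
  note sub = simple_graph_edge_subset[OF H]
  have injp: "inj_on p (q ` verts H)"
    by (rule inj_on_subset[OF inj_p qV])
  have "plane_drawing H (p \<circ> q) (\<lambda>e. \<gamma> (q ` e))"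
    unfolding plane_drawing_def
  proof (intro conjI ballI impI)
    show "inj_on (p \<circ> q) (verts H)"
      using inj injp by (rule comp_inj_on)
  next
    fix e assume e: "e \<in> edges H"
    show "arc (\<gamma> (q ` e))"
      using arc[OF qE[OF e]] .
    show "{pathstart (\<gamma> (q ` e)), pathfinish (\<gamma> (q ` e))} = (p \<circ> q) ` e"
      using ends[OF qE[OF e]] by (simp only: image_comp)
    have "X \<inter> V = E" if "X \<inter> W = E" "V \<subseteq> W" "E \<subseteq> V" for X V W E :: "complex set"
      using that by blast
    from this[OF verts_on[OF qE[OF e]] image_mono[OF qV] image_mono[OF image_mono[OF sub[OF e]]]]
    show "path_image (\<gamma> (q ` e)) \<inter> (p \<circ> q) ` verts H = (p \<circ> q) ` e"
      by (simp only: image_comp)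
  next
    fix e f assume e: "e \<in> edges H" and f: "f \<in> edges H" and "e \<noteq> f"
    then have "q ` e \<noteq> q ` f"
      using inj_on_image_eq_iff[OF inj sub[OF e] sub[OF f]] by simp
    then have "path_image (\<gamma> (q ` e)) \<inter> path_image (\<gamma> (q ` f)) = p ` (q ` e \<inter> q ` f)"
      by (rule meet[OF qE[OF e] qE[OF f]])
    also have "q ` e \<inter> q ` f = q ` (e \<inter> f)"
      using inj_on_image_Int[OF inj sub[OF e] sub[OF f]] by simp
    finally show "path_image (\<gamma> (q ` e)) \<inter> path_image (\<gamma> (q ` f)) = (p \<circ> q) ` (e \<inter> f)"
      by (simp add: image_comp)
  qed
  then show ?thesis by (auto simp: planar_def)
qed

text \<open>
  Compose the drawing with a map \<open>\<Phi>\<close> that collapses the arc of \<open>uv\<close>, and draw each edge of the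
  contraction as the image of one chosen preimage. Another edge meets the collapsed arc at most in a
  common endpoint, so \<open>\<Phi>\<close> is injective on it; two edges whose images newly meet both had an
  endpoint in \<open>{u, v}\<close>, so they share \<open>u\<close> after the contraction.
\<close>

lemma planar_contract_edge:
  assumes G: "simple_graph G" and uv: "{u, v} \<in> edges G" and "planar G"
  shows "planar (contract_edge G u v)"
proof -
  obtain p \<gamma> where d: "plane_drawing G p \<gamma>"
    using \<open>planar G\<close> by (auto simp: planar_def)
  have inj_p: "inj_on p (verts G)"
    and arc: "\<And>e. e \<in> edges G \<Longrightarrow> arc (\<gamma> e)"
    and ends: "\<And>e. e \<in> edges G \<Longrightarrow> {pathstart (\<gamma> e), pathfinish (\<gamma> e)} = p ` e"
    and verts_on: "\<And>e. e \<in> edges G \<Longrightarrow> path_image (\<gamma> e) \<inter> p ` verts G = p ` e"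
    and meet: "\<And>e f. e \<in> edges G \<Longrightarrow> f \<in> edges G \<Longrightarrow> e \<noteq> f \<Longrightarrow>
                 path_image (\<gamma> e) \<inter> path_image (\<gamma> f) = p ` (e \<inter> f)"
    using d by (auto simp: plane_drawing_def)
  define C where "C = contract_edge G u v"
  define \<pi> where "\<pi> = contract_map u v"
  define A where "A = path_image (\<gamma> {u, v})"
  obtain \<Phi> :: "complex \<Rightarrow> complex" where cont: "continuous_on UNIV \<Phi>"
    and \<Phi>: "\<And>x y. \<Phi> x = \<Phi> y \<longleftrightarrow> x = y \<or> x \<in> A \<and> y \<in> A"
    unfolding A_def using arc_collapsing_map[OF arc[OF uv]] by blast
  have uV: "u \<in> verts G" and vV: "v \<in> verts G" and "u \<noteq> v"
    using simple_graph_edge_subset[OF G uv] simple_graph_edge_neq[OF G uv] by auto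
  have vC: "verts C = verts G - {v}"
    by (simp add: C_def contract_edge_def)
  have pA: "p x \<in> A \<longleftrightarrow> x = u \<or> x = v" if "x \<in> verts G" for x
  proof -
    have "p x \<in> A \<longleftrightarrow> p x \<in> p ` {u, v}"
      using verts_on[OF uv] that unfolding A_def by blast
    also have "\<dots> \<longleftrightarrow> x = u \<or> x = v"
      using inj_p that uV vV by (auto simp: inj_on_def)
    finally show ?thesis .
  qed
  have \<Phi>p: "\<Phi> (p x) = \<Phi> (p y) \<longleftrightarrow> \<pi> x = \<pi> y" if "x \<in> verts G" "y \<in> verts G" for x y
    using that pA inj_p by (auto simp: \<Phi> \<pi>_def contract_map_def inj_on_def)
  have \<pi>V: "\<pi> x \<in> verts G" if "x \<in> verts G" for x
    using that uV by (simp add: \<pi>_def contract_map_def)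
  have \<pi>\<pi>: "\<pi> (\<pi> x) = \<pi> x" for x
    by (simp add: \<pi>_def contract_map_def)
  have \<Phi>p\<pi>: "\<Phi> (p (\<pi> x)) = \<Phi> (p x)" if "x \<in> verts G" for x
    using \<Phi>p[OF \<pi>V[OF that] that] \<pi>\<pi> by simp
  have \<Phi>p_image: "(\<Phi> \<circ> p) ` \<pi> ` e = \<Phi> ` p ` e" if "e \<subseteq> verts G" for e
    using that \<Phi>p\<pi> by (force simp: image_comp)
  have onA: "t \<in> p ` (e \<inter> {u, v})"
    if "e \<in> edges G" "e \<noteq> {u, v}" "t \<in> path_image (\<gamma> e)" "t \<in> A" for e t
    using meet[OF that(1) uv that(2)] that(3,4) by (auto simp: A_def)
  have u_in: "u \<in> \<pi> ` e \<and> \<Phi> t = \<Phi> (p u)"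
    if "e \<in> edges G" "e \<noteq> {u, v}" "t \<in> path_image (\<gamma> e)" "t \<in> A" for e t
    using onA[OF that] \<open>t \<in> A\<close> pA[OF uV] by (force simp: \<pi>_def contract_map_def \<Phi>)
  have inj_\<Phi>: "inj_on \<Phi> (path_image (\<gamma> e))" if e: "e \<in> edges G" "e \<noteq> {u, v}" for e
  proof (rule inj_onI)
    fix s t assume s: "s \<in> path_image (\<gamma> e)" and t: "t \<in> path_image (\<gamma> e)" and "\<Phi> s = \<Phi> t"
    have "\<not> {u, v} \<subseteq> e"
    proof -
      obtain a b where "e = {a, b}"
        using simple_graph_edgeE[OF G e(1)] .
      with e(2) \<open>u \<noteq> v\<close> show ?thesis by auto
    qed
    then have "s = t" if "s \<in> A" "t \<in> A"
      using onA[OF e s] onA[OF e t] that by auto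
    then show "s = t" using \<open>\<Phi> s = \<Phi> t\<close> \<Phi> by blast
  qed
  \<comment> \<open>If \<open>u\<close> and \<open>v\<close> have a common neighbour, two parallel edges are merged; any one of them will do.\<close>
  define lift where "lift e = (SOME e'. e' \<in> edges G - {{u, v}} \<and> \<pi> ` e' = e)" for e
  have lift: "lift e \<in> edges G" "lift e \<noteq> {u, v}" "\<pi> ` lift e = e" if "e \<in> edges C" for e
  proof -
    have "\<exists>e'. e' \<in> edges G - {{u, v}} \<and> \<pi> ` e' = e"
      using that unfolding C_def \<pi>_def edges_contract_edge[OF G, of u v] by (auto simp del: image_is_empty)
    from someI_ex[OF this]
    show "lift e \<in> edges G" "lift e \<noteq> {u, v}" "\<pi> ` lift e = e"
      unfolding lift_def by auto
  qed
  have p_image: "(\<Phi> \<circ> p) ` e = \<Phi> ` p ` lift e" if "e \<in> edges C" for e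
    using \<Phi>p_image[of "lift e"] lift[OF that] simple_graph_edge_subset[OF G] by metis
  have p_subset: "p ` lift e \<subseteq> path_image (\<gamma> (lift e))" if "e \<in> edges C" for e
    using verts_on lift[OF that] by blast
  have "plane_drawing C (\<Phi> \<circ> p) (\<lambda>e. \<Phi> \<circ> \<gamma> (lift e))"
    unfolding plane_drawing_def
  proof (intro conjI ballI impI)
    show "inj_on (\<Phi> \<circ> p) (verts C)"
      using \<Phi>p by (auto simp: inj_on_def vC \<pi>_def contract_map_def)
  next
    fix e assume e: "e \<in> edges C"
    have a: "arc (\<gamma> (lift e))"
      using arc lift[OF e] by blast
    then show "arc (\<Phi> \<circ> \<gamma> (lift e))"
      using inj_\<Phi>[of "lift e"] lift[OF e] continuous_on_subset[OF cont]
      unfolding arc_def by (auto intro!: path_continuous_image comp_inj_on simp: path_image_def)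
    show "{pathstart (\<Phi> \<circ> \<gamma> (lift e)), pathfinish (\<Phi> \<circ> \<gamma> (lift e))} = (\<Phi> \<circ> p) ` e"
      using ends[OF lift(1)[OF e]] p_image[OF e]
      by (metis image_empty image_insert pathfinish_compose pathstart_compose)
    show "path_image (\<Phi> \<circ> \<gamma> (lift e)) \<inter> (\<Phi> \<circ> p) ` verts C = (\<Phi> \<circ> p) ` e"
    proof (intro equalityI subsetI)
      fix z assume "z \<in> path_image (\<Phi> \<circ> \<gamma> (lift e)) \<inter> (\<Phi> \<circ> p) ` verts C"
      then have "z \<in> \<Phi> ` path_image (\<gamma> (lift e))" "z \<in> (\<Phi> \<circ> p) ` (verts G - {v})"
        unfolding path_image_compose vC by blast+
      then obtain t x where t: "t \<in> path_image (\<gamma> (lift e))" "z = \<Phi> t"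
        and x: "x \<in> verts G" "x \<noteq> v" "z = \<Phi> (p x)"
        by (elim imageE DiffE) auto
      show "z \<in> (\<Phi> \<circ> p) ` e"
      proof (cases "t = p x")
        case True
        then have "t \<in> p ` lift e"
          using verts_on[OF lift(1)[OF e]] t x by blast
        then show ?thesis using p_image[OF e] t by blast
      next
        case False
        then have "t \<in> A" using t x \<Phi> by metis
        then have "u \<in> e" "z = \<Phi> (p u)"
          using u_in[OF lift(1,2)[OF e] t(1)] lift(3)[OF e] t(2) by auto
        then show ?thesis by auto
      qed
    next
      fix z assume z: "z \<in> (\<Phi> \<circ> p) ` e"
      then have "z \<in> path_image (\<Phi> \<circ> \<gamma> (lift e))"
        using p_image[OF e] p_subset[OF e] by (auto simp: path_image_compose)
      moreover have "e \<subseteq> verts C"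
        using simple_graph_edge_subset[OF simple_graph_contract_edge[OF G uv], of e] e by (simp add: C_def)
      ultimately show "z \<in> path_image (\<Phi> \<circ> \<gamma> (lift e)) \<inter> (\<Phi> \<circ> p) ` verts C"
        using z by blast
    qed
  next
    fix e f assume e: "e \<in> edges C" and f: "f \<in> edges C" and "e \<noteq> f"
    then have ne: "lift e \<noteq> lift f" using lift(3) by metis
    show "path_image (\<Phi> \<circ> \<gamma> (lift e)) \<inter> path_image (\<Phi> \<circ> \<gamma> (lift f)) = (\<Phi> \<circ> p) ` (e \<inter> f)"
    proof (intro equalityI subsetI)
      fix z assume "z \<in> path_image (\<Phi> \<circ> \<gamma> (lift e)) \<inter> path_image (\<Phi> \<circ> \<gamma> (lift f))"
      then obtain s t where s: "s \<in> path_image (\<gamma> (lift e))" "z = \<Phi> s"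
        and t: "t \<in> path_image (\<gamma> (lift f))" "z = \<Phi> t"
        unfolding path_image_compose image_iff by blast
      show "z \<in> (\<Phi> \<circ> p) ` (e \<inter> f)"
      proof (cases "s = t")
        case True
        then obtain x where x: "s = p x" "x \<in> lift e" "x \<in> lift f"
          using meet[OF lift(1)[OF e] lift(1)[OF f] ne] s t by blast
        then have "z = (\<Phi> \<circ> p) (\<pi> x)"
          using \<Phi>p\<pi>[of x] s simple_graph_edge_subset[OF G lift(1)[OF e]] by auto
        moreover have "\<pi> x \<in> e \<inter> f"
          using lift(3)[OF e] lift(3)[OF f] x by blast
        ultimately show ?thesis by blast
      next
        case False
        then have "s \<in> A" "t \<in> A" using s t \<Phi> by metis+
        then have "u \<in> e \<inter> f" "z = (\<Phi> \<circ> p) u"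
          using u_in[OF lift(1,2)[OF e] s(1)] u_in[OF lift(1,2)[OF f] t(1)] lift(3) e f s(2) by auto
        then show ?thesis by blast
      qed
    next
      fix z assume "z \<in> (\<Phi> \<circ> p) ` (e \<inter> f)"
      then have "z \<in> \<Phi> ` p ` lift e" "z \<in> \<Phi> ` p ` lift f"
        using p_image[OF e] p_image[OF f] by blast+
      then show "z \<in> path_image (\<Phi> \<circ> \<gamma> (lift e)) \<inter> path_image (\<Phi> \<circ> \<gamma> (lift f))"
        using p_subset[OF e] p_subset[OF f] by (auto simp: path_image_compose)
    qed
  qed
  then show ?thesis by (auto simp: planar_def C_def)
qed

section \<open>Contraction preserves being close to a forest\<close>

text \<open>The form without modular indices, in which vertices can be inserted into a cycle.\<close>

lemma is_cycle_iff_successively: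
  "is_cycle G xs \<longleftrightarrow> length xs \<ge> 3 \<and> distinct xs \<and>
     successively (adjacent G) xs \<and> adjacent G (last xs) (hd xs)"
proof (cases "length xs \<ge> 3")
  case True
  then have ne: "xs \<noteq> []" by auto
  have "(\<forall>i<length xs. adjacent G (xs ! i) (xs ! (Suc i mod length xs))) \<longleftrightarrow>
      (\<forall>i. Suc i < length xs \<longrightarrow> adjacent G (xs ! i) (xs ! Suc i)) \<and>
      adjacent G (xs ! (length xs - 1)) (xs ! 0)" (is "?L \<longleftrightarrow> ?R")
  proof
    assume L: ?L
    have "adjacent G (xs ! i) (xs ! Suc i)" if "Suc i < length xs" for i
      using L[rule_format, of i] that by simp
    moreover have "adjacent G (xs ! (length xs - 1)) (xs ! 0)"
      using L[rule_format, of "length xs - 1"] ne by simp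
    ultimately show ?R by blast
  next
    assume R: ?R
    have "adjacent G (xs ! i) (xs ! (Suc i mod length xs))" if "i < length xs" for i
    proof (cases "Suc i = length xs")
      case True
      then have "i = length xs - 1" by simp
      then show ?thesis using R True by simp
    next
      case False
      then show ?thesis using R that by simp
    qed
    then show ?L by blast
  qed
  then show ?thesis
    using ne by (simp add: is_cycle_def successively_conv_nth last_conv_nth hd_conv_nth)
qed (simp add: is_cycle_def)

lemma adjacent_sym: "adjacent G x y \<longleftrightarrow> adjacent G y x"
  by (simp add: adjacent_def insert_commute)

lemma is_cycle_rotate:
  assumes "is_cycle G (xs @ y # ys)"
  shows "is_cycle G (y # ys @ xs)"
proof (cases "xs = []")
  case False
  then show ?thesis
    using assms unfolding is_cycle_iff_successively
    by (cases "ys = []") (simp_all add: successively_append_iff successively_Cons Int_commute)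
qed (use assms in simp)

lemma is_cycle_adjacent:
  assumes "is_cycle G xs" "x \<in> set xs"
  obtains y where "adjacent G x y"
proof -
  obtain i where "i < length xs" "x = xs ! i"
    using assms(2) by (auto simp: in_set_conv_nth)
  then have "adjacent G x (xs ! (Suc i mod length xs))"
    using assms(1) by (simp add: is_cycle_def)
  then show thesis by (rule that)
qed

lemma is_cycle_mono:
  assumes "is_cycle G xs" "\<And>x y. x \<in> set xs \<Longrightarrow> y \<in> set xs \<Longrightarrow> adjacent G x y \<Longrightarrow> adjacent H x y"
  shows "is_cycle H xs"
proof -
  have "Suc i mod length xs < length xs" if "i < length xs" for i
    using that by (intro mod_less_divisor) auto
  then have "adjacent H (xs ! i) (xs ! (Suc i mod length xs))" if "i < length xs" for i
    using that assms(1) by (intro assms(2)) (auto simp: is_cycle_def)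
  then show ?thesis
    using assms(1) by (simp add: is_cycle_def)
qed

lemma forest_mono: "forest G \<Longrightarrow> edges H \<subseteq> edges G \<Longrightarrow> forest H"
  unfolding forest_def using is_cycle_mono[of H _ G] by (simp add: adjacent_def subset_iff) metis

text \<open>
  A cycle of the contraction through \<open>u\<close> becomes a cycle of the original graph after replacing \<open>u\<close>
  by \<open>u\<close>, \<open>v\<close>, or the edge \<open>uv\<close> in one of its directions, according to which of \<open>u\<close> and \<open>v\<close>
  carries the two edges of the cycle at the merged vertex.
\<close>

lemma forest_contract_edge:
  assumes G: "simple_graph G" and uv: "{u, v} \<in> edges G" and "forest G"
  shows "forest (contract_edge G u v)"
  unfolding forest_def
proof
  define C where "C = contract_edge G u v"
  assume "\<exists>xs. is_cycle (contract_edge G u v) xs"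
  then obtain xs where xs: "is_cycle C xs"
    by (auto simp: C_def)
  have "u \<noteq> v" using simple_graph_edge_neq[OF G uv] .
  have C: "simple_graph C"
    unfolding C_def using simple_graph_contract_edge[OF G uv] .
  have adj_off: "adjacent G x y" if "adjacent C x y" "x \<noteq> u" "y \<noteq> u" for x y
    using that by (auto simp: adjacent_def C_def contract_edge_def doubleton_eq_iff)
  have adj_u: "adjacent G u y \<or> adjacent G v y" if "adjacent C u y" for y
    using that by (auto simp: adjacent_def C_def contract_edge_def doubleton_eq_iff)
  have "v \<notin> e" if "e \<in> edges C" for e
    using simple_graph_edge_subset[OF C that] by (auto simp: C_def contract_edge_def)
  then have "\<not> adjacent C v y" for y
    by (auto simp: adjacent_def)
  then have v: "v \<notin> set xs"
    using is_cycle_adjacent[OF xs] by metis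
  have no_cycle: "\<not> is_cycle G ys" for ys
    using \<open>forest G\<close> by (simp add: forest_def)
  show False
  proof (cases "u \<in> set xs")
    case False
    then have "is_cycle G xs"
      using adj_off by (intro is_cycle_mono[OF xs]) metis
    with no_cycle show False by blast
  next
    case True
    then obtain as bs where "xs = as @ u # bs"
      by (meson split_list)
    define ys where "ys = bs @ as"
    have ys: "is_cycle C (u # ys)"
      using is_cycle_rotate xs unfolding ys_def \<open>xs = as @ u # bs\<close> by fast
    have v': "v \<notin> set ys"
      using v by (auto simp: ys_def \<open>xs = as @ u # bs\<close>)
    have len: "length ys \<ge> 2" and dist: "distinct ys" and u': "u \<notin> set ys"
      and ysC: "successively (adjacent C) ys" and hd: "adjacent C u (hd ys)"
      and last: "adjacent C (last ys) u" and ne: "ys \<noteq> []"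
      using ys by (auto simp: is_cycle_iff_successively successively_Cons split: if_splits)
    have ysG: "successively (adjacent G) ys"
      using ysC by (rule successively_mono) (use u' adj_off in metis)
    have "adjacent G u (hd ys) \<or> adjacent G v (hd ys)" "adjacent G u (last ys) \<or> adjacent G v (last ys)"
      using adj_u hd last adjacent_sym by metis+
    moreover have "adjacent G u v"
      using uv by (simp add: adjacent_def)
    ultimately have "is_cycle G (u # ys) \<or> is_cycle G (v # ys) \<or>
        is_cycle G (u # v # ys) \<or> is_cycle G (v # u # ys)"
      using len dist u' v' ne ysG \<open>u \<noteq> v\<close> adjacent_sym[of G]
      by (auto simp: is_cycle_iff_successively successively_Cons)
    with no_cycle show False by blast
  qed
qed

text \<open>
  If the deleted set meets \<open>{u, v}\<close>, deleting the merged vertex costs no more and leaves a subgraph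
  of the old forest. Otherwise deletion and contraction commute.
\<close>

lemma forest_after_removing_contract_edge:
  assumes G: "simple_graph G" and uv: "{u, v} \<in> edges G" and "forest_after_removing k G"
  shows "forest_after_removing k (contract_edge G u v)"
proof -
  obtain S where S: "S \<subseteq> verts G" "card S \<le> k" and forest: "forest (del_verts G S)"
    using assms(3) by (auto simp: forest_after_removing_def)
  have finS: "finite S"
    using S(1) G by (auto simp: simple_graph_def intro: finite_subset)
  have "u \<noteq> v" "u \<in> verts G"
    using simple_graph_edge_neq[OF G uv] simple_graph_edge_subset[OF G uv] by auto
  show ?thesis
  proof (cases "u \<in> S \<or> v \<in> S")
    case True
    define T where "T = insert u (S - {v})"
    have "card T \<le> card S"
    proof (cases "v \<in> S")
      case True
      have "card T \<le> Suc (card (S - {v}))"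
        unfolding T_def by (rule card_insert_le_m1) (use finS in auto)
      also have "\<dots> = card S"
        using card_Suc_Diff1[OF finS True] .
      finally show ?thesis .
    next
      case False
      with True have "T = S" by (auto simp: T_def)
      then show ?thesis by simp
    qed
    moreover have "T \<subseteq> verts (contract_edge G u v)"
      using S(1) \<open>u \<noteq> v\<close> \<open>u \<in> verts G\<close> by (auto simp: T_def contract_edge_def)
    moreover have "edges (del_verts (contract_edge G u v) T) \<subseteq> edges (del_verts G S)"
      by (auto simp: del_verts_def contract_edge_def T_def)
    ultimately show ?thesis
      using forest_mono[OF forest] S(2) by (auto simp: forest_after_removing_def)
  next
    case False
    have "{u, v} \<in> edges (del_verts G S)"
      using uv False by (simp add: del_verts_def)
    then have "forest (contract_edge (del_verts G S) u v)"
      using forest_contract_edge[OF simple_graph_del_verts[OF G]] forest by blast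
    moreover have "edges (del_verts (contract_edge G u v) S) \<subseteq> edges (contract_edge (del_verts G S) u v)"
      using False by (auto simp: del_verts_def contract_edge_def)
    ultimately have "forest (del_verts (contract_edge G u v) S)"
      by (rule forest_mono)
    moreover have "S \<subseteq> verts (contract_edge G u v)"
      using S(1) False by (auto simp: contract_edge_def)
    ultimately show ?thesis
      using S(2) by (auto simp: forest_after_removing_def)
  qed
qed

lemma forest_after_removing_embeds:
  assumes H: "simple_graph H" and K: "simple_graph K" and q: "embeds q H K"
    and "forest_after_removing k K"
  shows "forest_after_removing k H"
proof -
  obtain S where S: "S \<subseteq> verts K" "card S \<le> k" and forest: "forest (del_verts K S)"
    using assms(4) by (auto simp: forest_after_removing_def)
  define T where "T = {x \<in> verts H. q x \<in> S}"
  have inj: "inj_on q (verts H)" and qE: "\<And>e. e \<in> edges H \<Longrightarrow> q ` e \<in> edges K"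
    using q by (auto simp: embeds_def)
  have "finite S"
    using S(1) K by (auto simp: simple_graph_def intro: finite_subset)
  then have "card T \<le> card S"
    using inj by (intro card_inj_on_le[of q]) (auto simp: T_def inj_on_def)
  moreover have "forest (del_verts H T)"
    unfolding forest_def
  proof
    assume "\<exists>xs. is_cycle (del_verts H T) xs"
    then obtain xs where xs: "is_cycle (del_verts H T) xs" ..
    have "x \<in> verts H" if x: "x \<in> set xs" for x
    proof -
      obtain y where "adjacent (del_verts H T) x y"
        using is_cycle_adjacent[OF xs x] .
      then show ?thesis
        using simple_graph_edge_subset[OF H, of "{x, y}"] by (auto simp: adjacent_def del_verts_def)
    qed
    then have "distinct (map q xs)"
      using xs inj by (auto simp: is_cycle_def distinct_map inj_on_def)
    moreover have "adjacent (del_verts K S) (q x) (q y)" if "adjacent (del_verts H T) x y" for x y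
    proof -
      have "{x, y} \<in> edges H" "{x, y} \<inter> T = {}"
        using that by (auto simp: adjacent_def del_verts_def)
      moreover from this have "{x, y} \<subseteq> verts H"
        using simple_graph_edge_subset[OF H] by blast
      ultimately show ?thesis
        using qE[of "{x, y}"] by (auto simp: adjacent_def del_verts_def T_def)
    qed
    moreover have "Suc i mod length xs < length xs" if "i < length xs" for i
      using that by (intro mod_less_divisor) auto
    ultimately have "is_cycle (del_verts K S) (map q xs)"
      using xs by (auto simp: is_cycle_def)
    with forest show False by (auto simp: forest_def)
  qed
  ultimately show ?thesis
    using S(2) unfolding forest_after_removing_def T_def by (intro exI[of _ T]) (auto simp: T_def)
qed

definition planar_or_near_forest :: "nat \<Rightarrow> 'a graph \<Rightarrow> bool" where
  "planar_or_near_forest k G \<longleftrightarrow> planar G \<or> forest_after_removing k G"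

lemma planar_or_near_forest_embeds:
  assumes "simple_graph H" "simple_graph K" "embeds q H K" "planar_or_near_forest k K"
  shows "planar_or_near_forest k H"
  using assms(4) planar_embeds[OF assms(1,3)] forest_after_removing_embeds[OF assms(1-3)]
  unfolding planar_or_near_forest_def by blast

lemma planar_or_near_forest_contract_edge:
  assumes "simple_graph G" "{u, v} \<in> edges G" "planar_or_near_forest k G"
  shows "planar_or_near_forest k (contract_edge G u v)"
  using assms(3) planar_contract_edge[OF assms(1,2)] forest_after_removing_contract_edge[OF assms(1,2)]
  unfolding planar_or_near_forest_def by blast

section \<open>Reachability and graphs without cutvertices\<close>

abbreviation reaches :: "'a graph \<Rightarrow> 'a \<Rightarrow> 'a \<Rightarrow> bool" where
  "reaches G \<equiv> (adjacent G)\<^sup>*\<^sup>*"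

definition linked :: "'a graph \<Rightarrow> bool" where
  "linked G \<longleftrightarrow> (\<forall>x\<in>verts G. \<forall>y\<in>verts G. reaches G x y)"

lemma reaches_sym: "reaches G x y \<Longrightarrow> reaches G y x"
proof -
  have "symp (adjacent G)"
    by (rule sympI) (simp add: adjacent_sym)
  then show "reaches G x y \<Longrightarrow> reaches G y x"
    by (rule sympD[OF symp_rtranclp])
qed

lemma reaches_map:
  assumes "reaches G x y" "\<And>a b. adjacent G a b \<Longrightarrow> reaches H (f a) (f b)"
  shows "reaches H (f x) (f y)"
  using assms(1)
proof induction
  case (step y z)
  then show ?case using assms(2)[of y z] by (auto intro: rtranclp_trans)
qed simp

lemma reaches_mono:
  assumes "reaches G x y" "\<And>a b. adjacent G a b \<Longrightarrow> adjacent H a b"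
  shows "reaches H x y"
  using reaches_map[OF assms(1), of H id] assms(2) by auto

lemma linkedI_hub:
  assumes "\<And>x. x \<in> verts G \<Longrightarrow> reaches G x z"
  shows "linked G"
  unfolding linked_def by (auto intro: rtranclp_trans[OF assms reaches_sym[OF assms]])

lemma component_of_eq_iff:
  assumes "x \<in> verts G"
  shows "component_of G x = component_of G y \<longleftrightarrow> reaches G x y"
proof
  assume "component_of G x = component_of G y"
  moreover have "x \<in> component_of G x"
    using assms by (simp add: component_of_def)
  ultimately have "reaches G y x"
    by (simp add: component_of_def)
  then show "reaches G x y" by (rule reaches_sym)
next
  assume xy: "reaches G x y"
  then have "reaches G x w \<longleftrightarrow> reaches G y w" for w
    using rtranclp_trans[OF xy, of w] rtranclp_trans[OF reaches_sym[OF xy], of w] by blast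
  then show "component_of G x = component_of G y"
    by (simp add: component_of_def)
qed

text \<open>
  Quantifying over all \<open>w\<close>, whether or not they are vertices, is harmless since deleting a non-vertex
  changes nothing, and it spares a membership condition at each use.
\<close>

lemma connected_no_cutvertex_iff:
  assumes B: "simple_graph B"
  shows "connected_no_cutvertex B \<longleftrightarrow>
    verts B \<noteq> {} \<and> linked B \<and> (\<forall>w. linked (del_verts B {w}))"
proof -
  have conn: "connected_graph B \<longleftrightarrow> verts B \<noteq> {} \<and> linked B"
    by (auto simp: connected_graph_def linked_def component_of_eq_iff)
  have "(\<nexists>w. cutvertex B w) \<longleftrightarrow> (\<forall>w. linked (del_verts B {w}))" if "linked B"
  proof -
    have "\<not> cutvertex B w \<longleftrightarrow> linked (del_verts B {w})" for w
    proof (cases "w \<in> verts B")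
      case True
      have V: "verts (del_verts B {w}) = verts B - {w}"
        by (simp add: del_verts_def)
      have "component_of B x = component_of B y" if "x \<in> verts B" "y \<in> verts B" for x y
        using that \<open>linked B\<close> by (simp add: component_of_eq_iff linked_def)
      then have "cutvertex B w \<longleftrightarrow> (\<exists>x\<in>verts B - {w}. \<exists>y\<in>verts B - {w}. \<not> reaches (del_verts B {w}) x y)"
        using True by (auto simp: cutvertex_def component_of_eq_iff V)
      then show ?thesis
        unfolding linked_def V by blast
    next
      case False
      have "w \<notin> e" if "e \<in> edges B" for e
        using simple_graph_edge_subset[OF B that] False by blast
      then have "del_verts B {w} = B"
        using False by (intro graph.expand) (auto simp: del_verts_def)
      then show ?thesis using False that by (simp add: cutvertex_def)
    qed
    then show ?thesis by blast
  qed
  then show ?thesis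
    unfolding connected_no_cutvertex_def conn by blast
qed

definition map_graph :: "('a \<Rightarrow> 'b) \<Rightarrow> 'a graph \<Rightarrow> 'b graph" where
  "map_graph f G = Graph (f ` verts G) ((\<lambda>e. f ` e) ` edges G)"

lemma connected_no_cutvertex_map_graph:
  assumes B: "simple_graph B" and inj: "inj_on f (verts B)" and c: "connected_no_cutvertex B"
  shows "simple_graph (map_graph f B)" "connected_no_cutvertex (map_graph f B)"
proof -
  show s: "simple_graph (map_graph f B)"
    unfolding simple_graph_def
  proof (intro conjI ballI)
    show "finite (verts (map_graph f B))"
      using B by (simp add: map_graph_def simple_graph_def)
    fix e assume "e \<in> edges (map_graph f B)"
    then obtain e' where e': "e' \<in> edges B" "e = f ` e'"
      by (auto simp: map_graph_def)
    obtain x y where "e' = {x, y}" "x \<noteq> y" "x \<in> verts B" "y \<in> verts B"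
      using simple_graph_edgeE[OF B e'(1)] .
    then have "f x \<in> verts (map_graph f B)" "f y \<in> verts (map_graph f B)" "f x \<noteq> f y" "e = {f x, f y}"
      using inj e'(2) by (auto simp: map_graph_def inj_on_eq_iff)
    then show "\<exists>u\<in>verts (map_graph f B). \<exists>v\<in>verts (map_graph f B). u \<noteq> v \<and> e = {u, v}"
      by blast
  qed
  have del: "linked (del_verts (map_graph f B) (f ` S))" if S: "S \<subseteq> verts B" "linked (del_verts B S)" for S
  proof -
    have "adjacent (del_verts (map_graph f B) (f ` S)) (f a) (f b)"
      if "adjacent (del_verts B S) a b" for a b
    proof -
      have e: "{a, b} \<in> edges B" "{a, b} \<inter> S = {}"
        using that by (auto simp: adjacent_def del_verts_def)
      then have "f ` {a, b} \<inter> f ` S = {}"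
        using inj_on_image_Int[OF inj simple_graph_edge_subset[OF B e(1)] S(1)] by simp
      moreover have "f ` {a, b} \<in> edges (map_graph f B)"
        using e by (simp only: map_graph_def graph.sel imageI)
      ultimately show ?thesis
        by (simp add: adjacent_def del_verts_def)
    qed
    then have "reaches (del_verts (map_graph f B) (f ` S)) (f x) (f y)"
      if "reaches (del_verts B S) x y" for x y
      using reaches_map[OF that] by blast
    moreover have "verts (del_verts (map_graph f B) (f ` S)) \<subseteq> f ` verts (del_verts B S)"
      by (auto simp: del_verts_def map_graph_def)
    ultimately show ?thesis
      using S(2) unfolding linked_def by blast
  qed
  have "linked B" "\<And>w. linked (del_verts B {w})" "verts B \<noteq> {}"
    using c by (auto simp: connected_no_cutvertex_iff[OF B])
  then have 1: "linked (map_graph f B)"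
    using del[of "{}"] by (simp add: del_verts_def graph.expand)
  have 2: "linked (del_verts (map_graph f B) {w})" for w
  proof (cases "w \<in> f ` verts B")
    case True
    then show ?thesis
      using del[of "{_}"] \<open>\<And>w. linked (del_verts B {w})\<close> by auto
  next
    case False
    then have "del_verts (map_graph f B) {w} = map_graph f B"
      using simple_graph_edge_subset[OF B]
      by (intro graph.expand) (fastforce simp: del_verts_def map_graph_def)
    with 1 show ?thesis by simp
  qed
  show "connected_no_cutvertex (map_graph f B)"
    unfolding connected_no_cutvertex_iff[OF s]
    using 1 2 \<open>verts B \<noteq> {}\<close> by (simp add: map_graph_def)
qed

section \<open>From blocks to arbitrary subgraphs without cutvertices\<close>

text \<open>
  The class described without maximality: all connected subgraphs without a cutvertex are tested,
  not only the blocks.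
\<close>

definition blockwise_good :: "nat \<Rightarrow> 'a graph \<Rightarrow> bool" where
  "blockwise_good k G \<longleftrightarrow> simple_graph G \<and>
     (\<forall>B. subgraph B G \<and> connected_no_cutvertex B \<longrightarrow> planar_or_near_forest k B)"

text \<open>Among the finitely many candidates above \<open>B\<close>, one with the most vertices and edges is maximal.\<close>

lemma subgraph_extends_to_block:
  assumes G: "simple_graph G" and B: "subgraph B G" "connected_no_cutvertex B"
  obtains D where "block D G" "subgraph B D"
proof -
  define P where "P D \<longleftrightarrow> subgraph D G \<and> connected_no_cutvertex D \<and> subgraph B D" for D
  define m where "m D = card (verts D) + card (edges D)" for D :: "'a graph"
  have finV: "finite (verts G)"
    using G by (simp add: simple_graph_def)
  have finE: "finite (edges G)"
    by (rule finite_subset[of _ "Pow (verts G)"]) (use simple_graph_edge_subset[OF G] finV in auto)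
  have fin: "finite (verts D)" "finite (edges D)" if "subgraph D G" for D
    using that finV finE by (auto simp: subgraph_def intro: finite_subset)
  have "P B"
    using B by (auto simp: P_def subgraph_def)
  moreover have "m D < Suc (m G)" if "P D" for D
    using that finV finE by (auto simp: P_def m_def subgraph_def less_Suc_eq_le intro!: add_mono card_mono)
  ultimately obtain D where D: "P D" "\<And>D'. P D' \<Longrightarrow> m D' \<le> m D"
    using ex_has_greatest_nat[of P B m "Suc (m G)"] by (metis less_imp_le)
  have "D' = D" if D': "subgraph D' G" "connected_no_cutvertex D'" "subgraph D D'" for D'
  proof -
    have "P D'"
      using D' D(1) subgraph_trans unfolding P_def by blast
    then have "m D' \<le> m D" by (rule D(2))
    moreover have sub: "verts D \<subseteq> verts D'" "edges D \<subseteq> edges D'"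
      using D'(3) by (auto simp: subgraph_def)
    moreover have "card (verts D) \<le> card (verts D')" "card (edges D) \<le> card (edges D')"
      using sub fin[OF D'(1)] by (auto intro: card_mono)
    ultimately have "card (verts D) = card (verts D')" "card (edges D) = card (edges D')"
      unfolding m_def by linarith+
    then have "verts D = verts D'" "edges D = edges D'"
      using sub fin[OF D'(1)] by (simp_all add: card_subset_eq)
    then show ?thesis by (simp add: graph.expand)
  qed
  then have "block D G" "subgraph B D"
    using D(1) by (auto simp: block_def P_def)
  then show thesis by (rule that)
qed

lemma block_class_eq: "block_class k = {G. blockwise_good k G}"
proof -
  have "(\<forall>B. block B G \<longrightarrow> planar_or_near_forest k B) \<longleftrightarrow>
      (\<forall>B. subgraph B G \<and> connected_no_cutvertex B \<longrightarrow> planar_or_near_forest k B)" (is "?L \<longleftrightarrow> ?R")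
    if G: "simple_graph G" for G :: "'a graph"
  proof
    assume L: ?L
    show ?R
    proof (intro allI impI)
      fix B assume B: "subgraph B G \<and> connected_no_cutvertex B"
      then obtain D where D: "block D G" "subgraph B D"
        using subgraph_extends_to_block[OF G] by blast
      then have "simple_graph B" "simple_graph D"
        using B by (auto simp: block_def subgraph_def)
      then show "planar_or_near_forest k B"
        using L D planar_or_near_forest_embeds[OF _ _ subgraph_embeds] by blast
    qed
  qed (auto simp: block_def)
  then show ?thesis
    by (auto simp: block_class_def blockwise_good_def planar_or_near_forest_def)
qed

text \<open>
  The image of \<open>B\<close> is a connected subgraph of \<open>K\<close> without a cutvertex, hence good, and goodness is
  pulled back along the embedding.
\<close>

lemma blockwise_good_embeds:
  assumes K: "blockwise_good k K" and B: "simple_graph B" "connected_no_cutvertex B" and q: "embeds q B K"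
  shows "planar_or_near_forest k B"
proof -
  have inj: "inj_on q (verts B)"
    using q by (simp add: embeds_def)
  note D = connected_no_cutvertex_map_graph[OF B(1) inj B(2)]
  have "subgraph (map_graph q B) K"
    using D(1) q by (auto simp: subgraph_def embeds_def map_graph_def)
  then have "planar_or_near_forest k (map_graph q B)"
    using K D(2) by (simp add: blockwise_good_def)
  moreover have "embeds q B (map_graph q B)"
    using inj by (auto simp: embeds_def map_graph_def)
  ultimately show ?thesis
    using B(1) D(1) planar_or_near_forest_embeds by blast
qed

section \<open>Contracting an edge of a graph in the class\<close>

text \<open>
  The largest subgraph of \<open>G\<close> that contraction of \<open>uv\<close> turns into \<open>B\<close>; here \<open>B\<close> is a subgraph of the
  contraction of \<open>G\<close> and contains \<open>u\<close>.
\<close>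

definition uncontract :: "'a graph \<Rightarrow> 'a \<Rightarrow> 'a \<Rightarrow> 'a graph \<Rightarrow> 'a graph" where
  "uncontract G u v B = Graph (insert v (verts B))
     (insert {u, v} {e \<in> edges G. contract_map u v ` e \<in> edges B})"

text \<open>
  Walks lift along the contraction: each edge has a preimage, and consecutive preimages are joined, if
  necessary, through the edge \<open>uv\<close>, which survives since \<open>W\<close> avoids both ends.
\<close>

lemma reaches_uncontract:
  assumes uv: "u \<notin> W" "v \<notin> W"
    and G: "simple_graph G" and B: "subgraph B (contract_edge G u v)"
    and "reaches (del_verts B W) (contract_map u v x) (contract_map u v y)"
  shows "reaches (del_verts (uncontract G u v B) W) x y"
proof -
  define L where "L = del_verts (uncontract G u v B) W"
  have uvL: "adjacent L u v"
    using uv by (auto simp: L_def adjacent_def del_verts_def uncontract_def)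
  have fibre: "reaches L a b" if ab: "contract_map u v a = contract_map u v b" for a b
  proof -
    consider "a = b" | "a = u" "b = v" | "a = v" "b = u"
      using ab by (auto simp: contract_map_def split: if_splits)
    then show ?thesis
      using uvL adjacent_sym[of L u v] by cases auto
  qed
  have edge: "reaches L a b" if ab: "adjacent (del_verts B W) (contract_map u v a) (contract_map u v b)" for a b
  proof -
    let ?e = "{contract_map u v a, contract_map u v b}"
    have e: "?e \<in> edges B" "?e \<inter> W = {}"
      using ab by (auto simp: adjacent_def del_verts_def)
    then have "?e \<in> (\<lambda>e. contract_map u v ` e) ` (edges G - {{u, v}})"
      using B unfolding edges_contract_edge[OF G, of u v, symmetric] subgraph_def by blast
    then obtain e' where e': "e' \<in> edges G" "contract_map u v ` e' = ?e"
      by (elim imageE DiffE) simp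
    have "e' \<inter> W = {}"
    proof (rule ccontr)
      assume "e' \<inter> W \<noteq> {}"
      then obtain x where "x \<in> e'" "x \<in> W" by blast
      moreover from this have "contract_map u v x = x"
        using uv by (auto simp: contract_map_def)
      ultimately have "x \<in> ?e \<inter> W" using e'(2) by force
      with e(2) show False by simp
    qed
    with e' e have e'L: "e' \<in> edges L"
      by (simp add: L_def del_verts_def uncontract_def)
    obtain c d where cd: "e' = {c, d}"
      using simple_graph_edgeE[OF G e'(1)] .
    have "reaches L c d" "reaches L d c"
      using e'L cd by (auto simp: adjacent_def insert_commute)
    moreover have "contract_map u v c = contract_map u v a \<and> contract_map u v d = contract_map u v b \<or>
        contract_map u v c = contract_map u v b \<and> contract_map u v d = contract_map u v a"
      using e'(2) cd by (simp add: doubleton_eq_iff)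
    ultimately obtain c' d' where "reaches L c' d'"
        "contract_map u v a = contract_map u v c'" "contract_map u v d' = contract_map u v b"
      by metis
    then show ?thesis
      using fibre[of a c'] fibre[of d' b] by (auto intro: rtranclp_trans)
  qed
  have "reaches L a b"
    if "reaches (del_verts B W) a' b'" "a' = contract_map u v a" "b' = contract_map u v b" for a a' b b'
    using that
  proof (induction arbitrary: b)
    case base
    then show ?case using fibre by simp
  next
    case (step c d)
    have "c \<noteq> v"
    proof -
      have "{c, d} \<in> edges B"
        using step.hyps(2) by (simp add: adjacent_def del_verts_def)
      then have "c \<in> verts B"
        using B simple_graph_edge_subset[of B "{c, d}"] by (simp add: subgraph_def)
      then show ?thesis
        using B by (auto simp: subgraph_def contract_edge_def)
    qed
    then have "c = contract_map u v c" by (simp add: contract_map_def)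
    then have "reaches L a c" "reaches L c b"
      using step edge[of c b] by auto
    then show ?case by (rule rtranclp_trans)
  qed
  then show ?thesis
    using assms(5) by (simp add: L_def)
qed

text \<open>
  Let \<open>B\<close> be a connected subgraph of the contraction without a cutvertex. If \<open>B\<close> avoids
  \<open>u\<close>, or if \<open>v\<close> is a leaf in the preimage of \<open>B\<close>, then \<open>B\<close> itself is a subgraph of \<open>G\<close>;
  if \<open>u\<close> is a leaf there, the copy of \<open>B\<close> with \<open>v\<close> in place of \<open>u\<close> is one. Otherwise \<open>u\<close> and \<open>v\<close> both have a further neighbour, and
  the preimage has no cutvertex: deleting any other vertex is handled by lifting walks from
  \<open>B\<close>, while deleting \<open>u\<close> or \<open>v\<close> leaves the connected graph \<open>B - u\<close> with the other end
  attached to it through its further neighbour.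
\<close>

lemma blockwise_good_contract_edge:
  assumes good: "blockwise_good k G" and uv: "{u, v} \<in> edges G"
  shows "blockwise_good k (contract_edge G u v)"
proof -
  have G: "simple_graph G" using good by (simp add: blockwise_good_def)
  have "u \<noteq> v" "u \<in> verts G" "v \<in> verts G"
    using simple_graph_edge_neq[OF G uv] simple_graph_edge_subset[OF G uv] by auto
  have "planar_or_near_forest k B"
    if BC: "subgraph B (contract_edge G u v)" and cB: "connected_no_cutvertex B" for B
  proof -
    have B: "simple_graph B" using BC by (simp add: subgraph_def)
    have vB: "v \<notin> verts B" and BG: "verts B \<subseteq> verts G"
      using BC by (auto simp: subgraph_def contract_edge_def)
    have vE: "v \<notin> e" if "e \<in> edges B" for e
      using simple_graph_edge_subset[OF B that] vB by blast
    have origin: "\<exists>e'\<in>edges G. e' \<noteq> {u, v} \<and> e = contract_map u v ` e'" if "e \<in> edges B" for e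
    proof -
      have "e \<in> (\<lambda>e. contract_map u v ` e) ` (edges G - {{u, v}})"
        using BC that unfolding edges_contract_edge[OF G, of u v, symmetric] subgraph_def by blast
      then show ?thesis by blast
    qed
    have off_v: "contract_map u v ` e = e" if "v \<notin> e" for e
      using that by (force simp: contract_map_def)
    consider "embeds id B G" | "embeds (contract_map v u) B G" | "\<not> embeds id B G" "\<not> embeds (contract_map v u) B G"
      by blast
    then show ?thesis
    proof cases
      case 1
      then show ?thesis by (rule blockwise_good_embeds[OF good B cB])
    next
      case 2
      then show ?thesis by (rule blockwise_good_embeds[OF good B cB])
    next
      case 3
      \<comment> \<open>An edge of \<open>B\<close> missing in \<open>G\<close> yields a neighbour \<open>z\<close> of \<open>v\<close>.\<close>
      have "\<not> edges B \<subseteq> edges G"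
        using 3(1) BG by (auto simp: embeds_def)
      then obtain e where e: "e \<in> edges B" "e \<notin> edges G" by blast
      then obtain e' where e': "e' \<in> edges G" "e' \<noteq> {u, v}" "e = contract_map u v ` e'"
        using origin by blast
      have "v \<in> e'" using e e' off_v by metis
      obtain z where z: "e' = {v, z}" "z \<noteq> v"
        using simple_graph_edge_at[OF G e'(1) \<open>v \<in> e'\<close>] by metis
      have "z \<noteq> u" using z e'(2) by (auto simp: insert_commute)
      have "e = {u, z}" using e'(3) z by (auto simp: contract_map_def)
      have uB: "u \<in> verts B" and zB: "z \<in> verts B"
        using simple_graph_edge_subset[OF B e(1)] \<open>e = {u, z}\<close> by auto
      \<comment> \<open>An edge of \<open>B\<close> that cannot be moved from \<open>u\<close> to \<open>v\<close> yields a neighbour \<open>y\<close> of \<open>u\<close>.\<close>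
      have "inj_on (contract_map v u) (verts B)" "contract_map v u ` verts B \<subseteq> verts G"
        using vB BG \<open>v \<in> verts G\<close> by (auto simp: inj_on_def contract_map_def)
      then obtain f where f: "f \<in> edges B" "contract_map v u ` f \<notin> edges G"
        using 3(2) by (auto simp: embeds_def)
      then obtain f' where f': "f' \<in> edges G" "f' \<noteq> {u, v}" "f = contract_map u v ` f'"
        using origin by blast
      have "v \<notin> f'"
      proof
        assume "v \<in> f'"
        then obtain w where w: "f' = {v, w}" "w \<noteq> v"
          using simple_graph_edge_at[OF G f'(1)] by metis
        then have "contract_map v u ` f = f'"
          using f' by (auto simp: contract_map_def)
        with f(2) f'(1) show False by simp
      qed
      then have "f \<in> edges G" using f' off_v by metis
      have "u \<in> f"
      proof (rule ccontr)
        assume "u \<notin> f"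
        then have "contract_map v u ` f = f" by (force simp: contract_map_def)
        with f(2) \<open>f \<in> edges G\<close> show False by simp
      qed
      then obtain y where y: "f = {u, y}" "y \<noteq> u"
        using simple_graph_edge_at[OF B f(1)] by metis
      have yB: "y \<in> verts B" using simple_graph_edge_subset[OF B f(1)] y by auto

      define L where "L = uncontract G u v B"
      have edges_L: "edges L = insert {u, v} {e \<in> edges G. contract_map u v ` e \<in> edges B}"
        and verts_L: "verts L = insert v (verts B)"
        by (simp_all add: L_def uncontract_def)
      have in_verts_L: "g \<subseteq> verts L" if "g \<in> edges L" for g
      proof (cases "g = {u, v}")
        case False
        then have "contract_map u v ` g \<subseteq> verts B"
          using that simple_graph_edge_subset[OF B] by (simp add: edges_L)
        then show ?thesis by (auto simp: verts_L contract_map_def split: if_splits)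
      qed (use uB in \<open>simp add: verts_L\<close>)
      have "edges L \<subseteq> edges G" using uv by (auto simp: edges_L)
      have "verts L \<subseteq> verts G" using BG \<open>v \<in> verts G\<close> by (simp add: verts_L)
      have L: "simple_graph L"
        unfolding simple_graph_def
      proof (intro conjI ballI)
        show "finite (verts L)" using B by (simp add: verts_L simple_graph_def)
        fix g assume g: "g \<in> edges L"
        then have "g \<in> edges G" using \<open>edges L \<subseteq> edges G\<close> by blast
        then obtain a b where "g = {a, b}" "a \<noteq> b"
          using simple_graph_edgeE[OF G] by metis
        with in_verts_L[OF g] show "\<exists>a\<in>verts L. \<exists>b\<in>verts L. a \<noteq> b \<and> g = {a, b}" by auto
      qed
      have "linked B" and linked_del_B: "\<And>w. linked (del_verts B {w})"
        using cB by (auto simp: connected_no_cutvertex_iff[OF B])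
      have contract_map_B: "contract_map u v x \<in> verts B" if "x \<in> verts L" for x
        using that uB by (auto simp: verts_L contract_map_def)
      have linked_L: "linked (del_verts L W)" if "u \<notin> W" "v \<notin> W" "linked (del_verts B W)" for W
        unfolding linked_def
      proof (intro ballI)
        fix x x' assume xx': "x \<in> verts (del_verts L W)" "x' \<in> verts (del_verts L W)"
        then have "contract_map u v x \<in> verts (del_verts B W)" "contract_map u v x' \<in> verts (del_verts B W)"
          using contract_map_B that by (auto simp: del_verts_def contract_map_def)
        then have "reaches (del_verts B W) (contract_map u v x) (contract_map u v x')"
          using that(3) by (simp add: linked_def)
        then show "reaches (del_verts L W) x x'"
          unfolding L_def by (rule reaches_uncontract[OF that(1,2) G BC])
      qed
      have adj_L: "adjacent (del_verts L {w}) a b" if "adjacent (del_verts B {u}) a b" "w = u \<or> w = v" for a b w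
      proof -
        have ab: "{a, b} \<in> edges B" "u \<notin> {a, b}"
          using that(1) by (auto simp: adjacent_def del_verts_def)
        then obtain g where g: "g \<in> edges G" "{a, b} = contract_map u v ` g"
          using origin by blast
        have "v \<notin> g" using ab(2) g(2) by (force simp: contract_map_def)
        then have "{a, b} \<in> edges L"
          using g ab(1) off_v by (auto simp: edges_L)
        then show ?thesis
          using that(2) ab vE[OF ab(1)] by (auto simp: adjacent_def del_verts_def)
      qed
      have reach_L: "reaches (del_verts L {w}) a b"
        if "a \<in> verts B" "b \<in> verts B" "a \<noteq> u" "b \<noteq> u" "w = u \<or> w = v" for a b w
      proof -
        have "reaches (del_verts B {u}) a b"
          using linked_del_B[of u] that by (simp add: linked_def del_verts_def)
        then show ?thesis
          using adj_L that(5) by (blast intro: reaches_mono)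
      qed
      have "linked (del_verts L {w})" for w
      proof -
        consider "w = u" | "w = v" | "w \<noteq> u" "w \<noteq> v" by blast
        then show ?thesis
        proof cases
          case 1
          have "adjacent (del_verts L {u}) v z"
            using e'(1,3) e(1) z \<open>z \<noteq> u\<close> \<open>u \<noteq> v\<close> by (auto simp: adjacent_def del_verts_def edges_L)
          then show ?thesis
            unfolding 1 using reach_L[OF _ zB _ \<open>z \<noteq> u\<close>, of _ u]
            by (intro linkedI_hub[of _ z]) (auto simp: del_verts_def verts_L)
        next
          case 2
          have "f \<in> edges L" "v \<notin> f"
            using \<open>f \<in> edges G\<close> f(1) vE[OF f(1)] off_v by (auto simp: edges_L)
          then have "adjacent (del_verts L {v}) u y"
            using y by (auto simp: adjacent_def del_verts_def)
          then show ?thesis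
            unfolding 2 using reach_L[OF _ yB _ \<open>y \<noteq> u\<close>, of _ v]
            by (intro linkedI_hub[of _ y]) (auto simp: del_verts_def verts_L)
        next
          case 3
          then show ?thesis using linked_L[of "{w}"] linked_del_B by simp
        qed
      qed
      moreover have "linked L"
        using linked_L[of "{}"] \<open>linked B\<close> by (simp add: del_verts_def linked_def adjacent_def[abs_def])
      ultimately have "connected_no_cutvertex L"
        by (simp add: connected_no_cutvertex_iff[OF L] verts_L)
      moreover have "subgraph L G"
        using L \<open>edges L \<subseteq> edges G\<close> \<open>verts L \<subseteq> verts G\<close> by (simp add: subgraph_def)
      ultimately have "planar_or_near_forest k L"
        using good by (simp add: blockwise_good_def)
      moreover have uvL: "{u, v} \<in> edges L" by (simp add: edges_L)
      ultimately have "planar_or_near_forest k (contract_edge L u v)"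
        using planar_or_near_forest_contract_edge[OF L] by blast
      moreover have "embeds id B (contract_edge L u v)"
      proof -
        have "g \<in> edges (contract_edge L u v)" if g: "g \<in> edges B" for g
        proof -
          obtain g' where "g' \<in> edges G" "g' \<noteq> {u, v}" "g = contract_map u v ` g'"
            using origin[OF g] by blast
          with \<open>g \<in> edges B\<close> show ?thesis
            unfolding edges_contract_edge[OF L] by (intro image_eqI[of _ _ g']) (auto simp: edges_L)
        qed
        then show ?thesis
          using vB by (auto simp: embeds_def contract_edge_def[of L] verts_L)
      qed
      ultimately show ?thesis
        using planar_or_near_forest_embeds[OF B simple_graph_contract_edge[OF L uvL]] by blast
    qed
  qed
  then show ?thesis
    using simple_graph_contract_edge[OF G uv] by (simp add: blockwise_good_def)
qed

section \<open>Closure properties of the class\<close>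

lemma blockwise_good_subgraph:
  assumes G: "blockwise_good k G" and H: "subgraph H G"
  shows "blockwise_good k H"
proof -
  have "simple_graph H" using H by (simp add: subgraph_def)
  then show ?thesis
    using G subgraph_trans[OF _ H] by (simp add: blockwise_good_def)
qed

lemma blockwise_good_minor_step:
  assumes "minor_step G H" "blockwise_good k G"
  shows "blockwise_good k H"
  using assms
proof cases
  case (del_vertex v)
  then have "subgraph H G"
    using assms(2) simple_graph_del_verts[of G "{v}"]
    by (auto simp: subgraph_def blockwise_good_def del_verts_def)
  with assms(2) show ?thesis by (rule blockwise_good_subgraph)
next
  case (del_edge e)
  then have "subgraph H G"
    using assms(2) simple_graph_del_edge[of G e]
    by (auto simp: subgraph_def blockwise_good_def del_edge_def)
  with assms(2) show ?thesis by (rule blockwise_good_subgraph)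
next
  case (contract_edge u v)
  then show ?thesis using blockwise_good_contract_edge[OF assms(2)] by simp
qed

lemma blockwise_good_iso:
  assumes G: "blockwise_good k G" and iso: "graph_iso G H"
  shows "blockwise_good k H"
proof -
  obtain q where H: "simple_graph H" and q: "embeds q H G"
  proof (rule graph_iso_embeds[OF _ iso])
    show "simple_graph G" using G by (simp add: blockwise_good_def)
  qed
  have "planar_or_near_forest k B" if B: "subgraph B H" "connected_no_cutvertex B" for B
  proof (rule blockwise_good_embeds[OF G _ B(2)])
    show "simple_graph B" using B(1) by (simp add: subgraph_def)
    show "embeds (q \<circ> id) B G" using subgraph_embeds[OF B(1)] q by (rule embeds_comp)
  qed
  with H show ?thesis by (simp add: blockwise_good_def)
qed

text \<open>Adjacent vertices lie on the same side of the sum, so a connected subgraph lies in one summand.\<close>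

lemma blockwise_good_disjoint_sum:
  fixes G :: "'a graph" and H :: "'b graph"
  assumes G: "blockwise_good k G" and H: "blockwise_good k H"
  shows "blockwise_good k (disjoint_sum G H)"
proof -
  have sG: "simple_graph G" and sH: "simple_graph H"
    using assms by (auto simp: blockwise_good_def)
  have edges_sum: "edges (disjoint_sum G H) = (\<lambda>e. Inl ` e) ` edges G \<union> (\<lambda>e. Inr ` e) ` edges H"
    and verts_sum: "verts (disjoint_sum G H) = verts G <+> verts H"
    by (simp_all add: disjoint_sum_def)
  have "simple_graph (disjoint_sum G H)"
    unfolding simple_graph_def
  proof (intro conjI ballI)
    show "finite (verts (disjoint_sum G H))"
      using sG sH by (simp add: verts_sum simple_graph_def)
    fix e assume "e \<in> edges (disjoint_sum G H)"
    then consider e' where "e' \<in> edges G" "e = Inl ` e'" | e' where "e' \<in> edges H" "e = Inr ` e'"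
      by (auto simp: edges_sum)
    then show "\<exists>u\<in>verts (disjoint_sum G H). \<exists>v\<in>verts (disjoint_sum G H). u \<noteq> v \<and> e = {u, v}"
    proof cases
      case 1
      obtain x y where "e' = {x, y}" "x \<noteq> y" "x \<in> verts G" "y \<in> verts G"
        using simple_graph_edgeE[OF sG 1(1)] .
      then have "Inl x \<in> verts (disjoint_sum G H)" "Inl y \<in> verts (disjoint_sum G H)"
          "(Inl x :: 'a + 'b) \<noteq> Inl y" "e = {Inl x, Inl y}"
        using 1(2) by (auto simp: verts_sum)
      then show ?thesis by blast
    next
      case 2
      obtain x y where "e' = {x, y}" "x \<noteq> y" "x \<in> verts H" "y \<in> verts H"
        using simple_graph_edgeE[OF sH 2(1)] .
      then have "Inr x \<in> verts (disjoint_sum G H)" "Inr y \<in> verts (disjoint_sum G H)"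
          "(Inr x :: 'a + 'b) \<noteq> Inr y" "e = {Inr x, Inr y}"
        using 2(2) by (auto simp: verts_sum)
      then show ?thesis by blast
    qed
  qed
  moreover have "planar_or_near_forest k B"
    if BS: "subgraph B (disjoint_sum G H)" and cB: "connected_no_cutvertex B" for B
  proof -
    have B: "simple_graph B" using BS by (simp add: subgraph_def)
    have edges_B: "e \<in> (\<lambda>e. Inl ` e) ` edges G \<union> (\<lambda>e. Inr ` e) ` edges H" if "e \<in> edges B" for e
      using BS that by (auto simp: subgraph_def edges_sum)
    have side: "isl x = isl y" if "adjacent B x y" for x y
    proof -
      have "{x, y} \<in> (\<lambda>e. Inl ` e) ` edges G \<union> (\<lambda>e. Inr ` e) ` edges H"
        using that edges_B by (simp add: adjacent_def)
      then have "{x, y} \<subseteq> range Inl \<or> {x, y} \<subseteq> range Inr" by blast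
      then show ?thesis by auto
    qed
    have side': "isl x = isl y" if "reaches B x y" for x y
      using that by induction (use side in auto)
    have "linked B" using cB by (simp add: connected_no_cutvertex_iff[OF B])
    then have same: "isl x = isl y" if "x \<in> verts B" "y \<in> verts B" for x y
      using that side' by (auto simp: linked_def)
    have VB: "verts B \<subseteq> verts G <+> verts H"
      using BS by (simp add: subgraph_def verts_sum)
    have ne: "e \<noteq> {}" if "e \<in> edges B" for e
      by (rule simple_graph_edgeE[OF B that]) simp
    show ?thesis
    proof (cases "\<exists>x\<in>verts B. isl x")
      case True
      then have l: "isl x" if "x \<in> verts B" for x using same that by blast
      have "projl ` e \<in> edges G" if e: "e \<in> edges B" for e
      proof -
        obtain x where "x \<in> e" using ne[OF e] by blast
        then have "isl x" using l simple_graph_edge_subset[OF B e] by blast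
        with \<open>x \<in> e\<close> have "e \<notin> (\<lambda>e. Inr ` e) ` edges H" by auto
        then obtain e' where "e' \<in> edges G" "e = Inl ` e'"
          using edges_B[OF e] by blast
        then show ?thesis by (simp add: image_image)
      qed
      moreover have "inj_on projl (verts B)"
        using l by (intro inj_onI) (metis sum.collapse(1))
      moreover have "projl ` verts B \<subseteq> verts G"
        using l VB by force
      ultimately have "embeds projl B G"
        by (simp add: embeds_def)
      then show ?thesis by (rule blockwise_good_embeds[OF G B cB])
    next
      case False
      then have r: "\<not> isl x" if "x \<in> verts B" for x using that by blast
      have "projr ` e \<in> edges H" if e: "e \<in> edges B" for e
      proof -
        obtain x where "x \<in> e" using ne[OF e] by blast
        then have "\<not> isl x" using r simple_graph_edge_subset[OF B e] by blast
        with \<open>x \<in> e\<close> have "e \<notin> (\<lambda>e. Inl ` e) ` edges G" by auto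
        then obtain e' where "e' \<in> edges H" "e = Inr ` e'"
          using edges_B[OF e] by blast
        then show ?thesis by (simp add: image_image)
      qed
      moreover have "inj_on projr (verts B)"
        using r by (intro inj_onI) (metis sum.collapse(2))
      moreover have "projr ` verts B \<subseteq> verts H"
        using r VB by force
      ultimately have "embeds projr B H"
        by (simp add: embeds_def)
      then show ?thesis by (rule blockwise_good_embeds[OF H B cB])
    qed
  qed
  ultimately show ?thesis by (simp add: blockwise_good_def)
qed

text \<open>
  A subgraph without a cutvertex that contains the new edge consists of this edge only: a third
  vertex would be joined to \<open>u\<close> avoiding \<open>v\<close> and to \<open>v\<close> avoiding \<open>u\<close>, which would connect \<open>u\<close> and
  \<open>v\<close> already in \<open>G\<close>. Since \<open>k \<ge> 1\<close>, one end of the edge may be deleted, and no edge is left.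
\<close>

lemma blockwise_good_add_edge:
  assumes good: "blockwise_good k G" and "k \<ge> 1" and u: "u \<in> verts G" and v: "v \<in> verts G"
    and sep: "component_of G u \<noteq> component_of G v"
  shows "blockwise_good k (add_edge G u v)"
proof -
  have G: "simple_graph G" using good by (simp add: blockwise_good_def)
  have "u \<noteq> v" using sep by blast
  have "simple_graph (add_edge G u v)"
    using G u v \<open>u \<noteq> v\<close> by (auto simp: simple_graph_def add_edge_def)
  moreover have "planar_or_near_forest k B"
    if BG: "subgraph B (add_edge G u v)" and cB: "connected_no_cutvertex B" for B
  proof (cases "{u, v} \<in> edges B")
    case False
    then have "subgraph B G"
      using BG by (auto simp: subgraph_def add_edge_def)
    then show ?thesis using good cB by (simp add: blockwise_good_def)
  next
    case True
    have B: "simple_graph B" using BG by (simp add: subgraph_def)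
    have uvB: "u \<in> verts B" "v \<in> verts B"
      using simple_graph_edge_subset[OF B True] by auto
    have "verts B \<subseteq> {u, v}"
    proof
      fix z assume z: "z \<in> verts B"
      show "z \<in> {u, v}"
      proof (rule ccontr)
        assume "z \<notin> {u, v}"
        have adj: "adjacent G a b" if "adjacent (del_verts B {w}) a b" "w = u \<or> w = v" for a b w
        proof -
          have "{a, b} \<in> edges B" "{a, b} \<noteq> {u, v}"
            using that by (auto simp: adjacent_def del_verts_def)
          then show ?thesis
            using BG by (auto simp: subgraph_def add_edge_def adjacent_def)
        qed
        have lk: "linked (del_verts B {w})" for w
          using cB by (simp add: connected_no_cutvertex_iff[OF B])
        have "reaches (del_verts B {v}) u z" "reaches (del_verts B {u}) z v"
          using lk[of u] lk[of v] uvB z \<open>z \<notin> {u, v}\<close> \<open>u \<noteq> v\<close>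
          by (auto simp: linked_def del_verts_def)
        then have "reaches G u z" "reaches G z v"
          using adj by (blast intro: reaches_mono)+
        then have "reaches G u v" by (rule rtranclp_trans)
        with sep show False by (simp add: component_of_eq_iff[OF u])
      qed
    qed
    have "edges (del_verts B {u}) = {}"
    proof -
      have "u \<in> e" if "e \<in> edges B" for e
        by (rule simple_graph_edgeE[OF B that]) (use \<open>verts B \<subseteq> {u, v}\<close> in auto)
      then show ?thesis by (auto simp: del_verts_def)
    qed
    then have "\<not> is_cycle (del_verts B {u}) xs" for xs
      by (cases xs) (auto simp: is_cycle_def adjacent_def)
    then have "forest (del_verts B {u})"
      by (simp add: forest_def)
    moreover have "card {u} \<le> k" using \<open>k \<ge> 1\<close> by simp
    ultimately show ?thesis
      using uvB(1) unfolding planar_or_near_forest_def forest_after_removing_def by blast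
  qed
  ultimately show ?thesis by (simp add: blockwise_good_def)
qed

theorem proposition2:
  fixes k :: nat
  assumes "k \<ge> 1"
  shows "addable (block_class k :: 'a graph set) \<and> minor_closed (block_class k :: 'a graph set)"
proof
  show "addable (block_class k :: 'a graph set)"
    unfolding addable_def block_class_eq
  proof (intro conjI ballI allI impI)
    fix G H K :: "'a graph"
    assume "G \<in> {G. blockwise_good k G}" "H \<in> {G. blockwise_good k G}" "graph_iso (disjoint_sum G H) K"
    then show "K \<in> {G. blockwise_good k G}"
      using blockwise_good_iso[OF blockwise_good_disjoint_sum] by simp
  next
    fix G :: "'a graph" and u v
    assume "G \<in> {G. blockwise_good k G}" "u \<in> verts G" "v \<in> verts G" "component_of G u \<noteq> component_of G v"
    then show "add_edge G u v \<in> {G. blockwise_good k G}"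
      using blockwise_good_add_edge[OF _ assms] by simp
  qed
  show "minor_closed (block_class k :: 'a graph set)"
    unfolding minor_closed_def block_class_eq mem_Collect_eq
  proof (intro ballI allI impI)
    fix G H :: "'a graph"
    assume "G \<in> {G. blockwise_good k G}" and "minor H G"
    then obtain H' where H': "minor_step\<^sup>*\<^sup>* G H'" "graph_iso H' H" and G: "blockwise_good k G"
      by (auto simp: minor_def)
    from H'(1) have "blockwise_good k H'"
      by induction (use G blockwise_good_minor_step in auto)
    then show "blockwise_good k H"
      using blockwise_good_iso[OF _ H'(2)] by simp
  qed
qed

end
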